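(* Consider the piecewise linear differential system $$\begin{cases}\dot x=T_Lx-y\\ \dot y=D_Lx-a_L\end{cases}\ \text{for } x<0,\qquad \begin{cases}\dot x=T_Rx-y\\ \dot y=D_Rx-a_R\end{cases}\ \text{for } x>0,$$ with real parameters. Let $\xi=a_RT_L-a_LT_R$, $c_0=a_Ra_L(a_RT_L-a_LT_R)$ and $c_\infty=T_L(T_L^2D_R-T_R^2D_L)$. Assume that both the forward Poincaré half-map $y_L$ and the backward Poincaré half-map $y_R$ exist, that $T_LT_R<0$, $c_0\neq0$, $4D_L-T_L^2>0$, $4D_R-T_R^2>0$, and that the system admits a unique monodromic singularity. If $\xi c_\infty>0$, then the system has a limit cycle.
   Context: The switching line is $\Sigma=\{(x,y):x=0\}$; trajectories are defined by Filippov's convention (they cross $\Sigma$ transversally except at the origin). Forward half-map $y_L$: for $y_0\ge0$ let $\varphi(t;y_0)=(\varphi_1,\varphi_2)$ be the orbit of the system with $\varphi(0;y_0)=(0,y_0)$. If there is $\tau_L(y_0)>0$ with $\varphi_1(\tau_L(y_0);y_0)=0$ and $\varphi_1(t;y_0)<0$ for all $t\in(0,\tau_L(y_0))$ (so that this arc is an orbit of the left linear system), put $y_L(y_0)=\varphi_2(\tau_L(y_0);y_0)\le0$. If for every $\varepsilon>0$ there are $y_0\in(0,\varepsilon)$ and $y_1\in(-\varepsilon,0)$ with $y_L(y_0)=y_1$, then $y_L$ is extended by $y_L(0)=0$. Backward half-map $y_R$: if there is $\tau_R(y_0)<0$ with $\varphi_1(\tau_R(y_0);y_0)=0$ and $\varphi_1(t;y_0)>0$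 for all $t\in(\tau_R(y_0),0)$, put $y_R(y_0)=\varphi_2(\tau_R(y_0);y_0)\le 0$, with the same kind of extension $y_R(0)=0$. A half-map exists if its domain is non-empty. Monodromic singularity: a point outside $\Sigma$ is a monodromic singularity if it is a focus or a center of the system (i.e. an equilibrium of focus or center type of the linear system governing the open half-plane where the point lies). The origin is a monodromic singularity if and only if [$a_L=0$ and $4D_L-T_L^2>0$, or $a_L>0$] and [$a_R=0$ and $4D_R-T_R^2>0$, or $a_R<0$]. No other point of $\Sigma$ is a monodromic singularity. A limit cycle is a non-trivial closed crossing orbit which is isolated from other closed orbits. *)

theory Defs
  imports "HOL-Analysis.Analysis"
begin

definition linear_field :: "real \<Rightarrow> real \<Rightarrow> real \<Rightarrow> real \<times> real \<Rightarrow> real \<times> real" where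
  "linear_field T D a p = (T * fst p - snd p, D * fst p - a)"

definition switching_line :: "(real \<times> real) set" where
  "switching_line = {p. fst p = 0}"


definition filippov_field ::
  "(real \<times> real \<Rightarrow> real \<times> real) \<Rightarrow> (real \<times> real \<Rightarrow> real \<times> real) \<Rightarrow>
     real \<times> real \<Rightarrow> (real \<times> real) set" where
  "filippov_field XL XR p =
     (if fst p < 0 then {XL p}
      else if fst p > 0 then {XR p}
      else convex hull {XL p, XR p})"

text \<open>
  A Filippov solution on an interval \<open>I\<close> is a locally absolutely continuous curve whose
  derivative lies in the set-valued field almost everywhere. Absolute continuity is expressed by
  saying that the curve is an indefinite Lebesgue integral of its derivative \<open>v\<close>.
\<close>

definition filippov_solution ::
  "(real \<times> real \<Rightarrow> real \<times> real) \<Rightarrow> (real \<times> real \<Rightarrow> real \<times> real) \<Rightarrow>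
     real set \<Rightarrow> (real \<Rightarrow> real \<times> real) \<Rightarrow> bool" where
  "filippov_solution XL XR I \<phi> \<longleftrightarrow>
     (\<exists>v. (\<forall>s\<in>I. \<forall>t\<in>I. s \<le> t \<longrightarrow>
            v absolutely_integrable_on {s..t} \<and> integral {s..t} v = \<phi> t - \<phi> s) \<and>
          negligible {t \<in> I. v t \<notin> filippov_field XL XR (\<phi> t)})"


definition left_arc ::
  "(real \<times> real \<Rightarrow> real \<times> real) \<Rightarrow> (real \<times> real \<Rightarrow> real \<times> real) \<Rightarrow> real \<Rightarrow> real \<Rightarrow> bool" where
  "left_arc XL XR y0 y1 \<longleftrightarrow>
     y0 \<ge> 0 \<and>
     (\<exists>\<phi> \<tau>. \<tau> > 0 \<and> filippov_solution XL XR {0..\<tau>} \<phi> \<and>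
        \<phi> 0 = (0, y0) \<and> \<phi> \<tau> = (0, y1) \<and> (\<forall>t\<in>{0<..<\<tau>}. fst (\<phi> t) < 0))"

definition right_arc ::
  "(real \<times> real \<Rightarrow> real \<times> real) \<Rightarrow> (real \<times> real \<Rightarrow> real \<times> real) \<Rightarrow> real \<Rightarrow> real \<Rightarrow> bool" where
  "right_arc XL XR y0 y1 \<longleftrightarrow>
     y0 \<ge> 0 \<and>
     (\<exists>\<phi> \<tau>. \<tau> < 0 \<and> filippov_solution XL XR {\<tau>..0} \<phi> \<and>
        \<phi> 0 = (0, y0) \<and> \<phi> \<tau> = (0, y1) \<and> (\<forall>t\<in>{\<tau><..<0}. fst (\<phi> t) > 0))"

text \<open>
  Extension of a partial half-map to the origin. For linear fields an arc is determined by its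
  starting point, so the definite description below is well defined.
\<close>

definition half_map_of_arcs :: "(real \<Rightarrow> real \<Rightarrow> bool) \<Rightarrow> real \<Rightarrow> real option" where
  "half_map_of_arcs A y0 =
     (if \<exists>y1. A y0 y1 then Some (THE y1. A y0 y1)
      else if y0 = 0 \<and> (\<forall>\<epsilon>>0. \<exists>u\<in>{0<..<\<epsilon>}. \<exists>w\<in>{-\<epsilon><..<0}. A u w) then Some 0
      else None)"

definition forward_half_map ::
  "(real \<times> real \<Rightarrow> real \<times> real) \<Rightarrow> (real \<times> real \<Rightarrow> real \<times> real) \<Rightarrow> real \<Rightarrow> real option" where
  "forward_half_map XL XR = half_map_of_arcs (left_arc XL XR)"

definition backward_half_map ::
  "(real \<times> real \<Rightarrow> real \<times> real) \<Rightarrow> (real \<times> real \<Rightarrow> real \<times> real) \<Rightarrow> real \<Rightarrow> real option" where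
  "backward_half_map XL XR = half_map_of_arcs (right_arc XL XR)"

definition half_map_exists :: "(real \<Rightarrow> real option) \<Rightarrow> bool" where
  "half_map_exists y \<longleftrightarrow> dom y \<noteq> {}"


definition jacobian_eigenvalue :: "real \<Rightarrow> real \<Rightarrow> complex \<Rightarrow> bool" where
  "jacobian_eigenvalue T D \<mu> \<longleftrightarrow>
     (\<exists>v :: complex ^ 2. v \<noteq> 0 \<and>
        vector [vector [of_real T, -1], vector [of_real D, 0]] *v v = \<mu> *s v)"

definition is_focus :: "real \<Rightarrow> real \<Rightarrow> real \<Rightarrow> real \<times> real \<Rightarrow> bool" where
  "is_focus T D a p \<longleftrightarrow>
     linear_field T D a p = 0 \<and> (\<exists>\<mu>. jacobian_eigenvalue T D \<mu> \<and> Im \<mu> \<noteq> 0 \<and> Re \<mu> \<noteq> 0)"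

definition is_center :: "real \<Rightarrow> real \<Rightarrow> real \<Rightarrow> real \<times> real \<Rightarrow> bool" where
  "is_center T D a p \<longleftrightarrow>
     linear_field T D a p = 0 \<and> (\<exists>\<mu>. jacobian_eigenvalue T D \<mu> \<and> Im \<mu> \<noteq> 0 \<and> Re \<mu> = 0)"

text \<open>
  Off the switching line the governing linear system must have a focus or a center at the point.
  On the switching line only the origin can be monodromic, and the last disjunct is the criterion
  for this: each side has a focus or center of its own at the origin, or an invisible fold
  there.
\<close>

definition monodromic_singularity ::
  "real \<Rightarrow> real \<Rightarrow> real \<Rightarrow> real \<Rightarrow> real \<Rightarrow> real \<Rightarrow> real \<times> real \<Rightarrow> bool" where
  "monodromic_singularity TL DL aL TR DR aR p \<longleftrightarrow>
     (fst p < 0 \<and> (is_focus TL DL aL p \<or> is_center TL DL aL p)) \<or>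
     (fst p > 0 \<and> (is_focus TR DR aR p \<or> is_center TR DR aR p)) \<or>
     (p = (0, 0) \<and>
        ((aL = 0 \<and> 4 * DL - TL\<^sup>2 > 0) \<or> aL > 0) \<and>
        ((aR = 0 \<and> 4 * DR - TR\<^sup>2 > 0) \<or> aR < 0))"


definition closed_orbit ::
  "(real \<times> real \<Rightarrow> real \<times> real) \<Rightarrow> (real \<times> real \<Rightarrow> real \<times> real) \<Rightarrow> (real \<times> real) set \<Rightarrow> bool" where
  "closed_orbit XL XR \<Gamma> \<longleftrightarrow>
     (\<exists>\<gamma> P. P > 0 \<and> filippov_solution XL XR UNIV \<gamma> \<and> (\<forall>t. \<gamma> (t + P) = \<gamma> t) \<and>
        (\<exists>s t. \<gamma> s \<noteq> \<gamma> t) \<and> \<Gamma> = range \<gamma>)"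

definition crossing_point ::
  "(real \<times> real \<Rightarrow> real \<times> real) \<Rightarrow> (real \<times> real \<Rightarrow> real \<times> real) \<Rightarrow> real \<times> real \<Rightarrow> bool" where
  "crossing_point XL XR p \<longleftrightarrow> p \<in> switching_line \<and> fst (XL p) * fst (XR p) > 0"

definition closed_crossing_orbit ::
  "(real \<times> real \<Rightarrow> real \<times> real) \<Rightarrow> (real \<times> real \<Rightarrow> real \<times> real) \<Rightarrow> (real \<times> real) set \<Rightarrow> bool" where
  "closed_crossing_orbit XL XR \<Gamma> \<longleftrightarrow>
     closed_orbit XL XR \<Gamma> \<and> \<Gamma> \<inter> switching_line \<noteq> {} \<and>
     (\<forall>p \<in> \<Gamma> \<inter> switching_line. crossing_point XL XR p)"

definition limit_cycle ::
  "(real \<times> real \<Rightarrow> real \<times> real) \<Rightarrow> (real \<times> real \<Rightarrow> real \<times> real) \<Rightarrow> (real \<times> real) set \<Rightarrow> bool" where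
  "limit_cycle XL XR \<Gamma> \<longleftrightarrow>
     closed_crossing_orbit XL XR \<Gamma> \<and>
     (\<exists>U. open U \<and> \<Gamma> \<subseteq> U \<and> (\<forall>\<Gamma>'. closed_orbit XL XR \<Gamma>' \<and> \<Gamma>' \<inter> U \<noteq> {} \<longrightarrow> \<Gamma>' = \<Gamma>))"

end

theory Submission
  imports Defs
begin

text \<open>
  In a zone with complex eigenvalues the orbits are logarithmic spirals around the equilibrium of
  the zone, and such a spiral has an explicit first integral. Restricted to the line \<open>x = 0\<close> it
  becomes a function \<open>level\<close> of the height alone, with derivative \<open>D y / quad y\<close> for a positive
  quadratic \<open>quad\<close>. Hence the point \<open>(0, u)\<close> is joined to \<open>(0, - v)\<close> by an arc in \<open>x < 0\<close> exactly when
  one scalar equation \<open>gap u v = 0\<close> holds, and \<open>gap\<close> decreases strictly in \<open>u\<close> and increases strictly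
  in \<open>v\<close>. The right zone becomes a left zone after a half-turn of the plane, and reversing time
  interchanges \<open>u\<close> and \<open>v\<close>. Crossing closed orbits therefore correspond to common zeros \<open>(u, v)\<close> of
  the gaps of two zones, with parameters \<open>(TL, DL, aL)\<close> and \<open>(- TR, DR, - aR)\<close>, whose traces have the
  same sign (\<open>left_half_arc\<close>, \<open>right_arc_both_ends\<close>).

  A common zero exists by the intermediate value theorem. After the symmetries are used, the
  first zone has \<open>a > 0\<close>, both traces are positive, and the two factors of \<open>\<xi> * cinf\<close> are positive. The
  zeros of the first gap then form the graph of a function \<open>depth\<close>. The second gap along this graph,
  \<open>mismatch u\<close>, is negative for small \<open>u\<close>, where the sign of \<open>\<xi>\<close> decides, and has a positive limit at
  infinity, where the sign of \<open>cinf\<close> decides. The uniqueness of the monodromic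
  singularity excludes that both zones contain their equilibrium, and this is what makes the
  normal form attainable.

  The common zero found in this way is isolated. The derivative of \<open>mismatch\<close> is a positive
  multiple of \<open>pencil u (- depth u)\<close>, where \<open>pencil\<close> is a polynomial of degree one in each variable, and
  this factor has only simple zeros along the graph, because \<open>depth u > u\<close>
  (\<open>pencil_nonzero_nearby\<close>). So near any point \<open>mismatch\<close> is strictly monotone on either side, and
  Rolle's theorem separates its zeros.

  It remains to compare with arbitrary Filippov solutions. The horizontal component of the field is
  single-valued and continuous, so every solution crosses the line transversally away from the
  origin and otherwise follows the linear flows. A closed orbit that comes close to the cycle
  therefore meets the positive half-line at a height close to \<open>u\<close>. The heights at which
  it meets the line form a closed set, arcs carry them to depths and back in either direction of time,
  and between the two monotone zero curves such a passage leads strictly closer to \<open>u\<close>. So the height nearest to \<open>u\<close> is \<open>u\<close>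
  itself (\<open>squeeze_to_common_zero\<close>), and the closed orbit is the cycle.
\<close>


section \<open>The spiral first integral on the line\<close>

text \<open>
  The locale describes the open half-plane \<open>x < 0\<close>. The condition \<open>a \<noteq> 0\<close> keeps the equilibrium off the
  line \<open>x = 0\<close>: it lies in the zone for \<open>a < 0\<close> and beyond the line for \<open>a > 0\<close>. A right zone with offset
  \<open>a\<close> is the half-turn image of a left zone with offset \<open>- a\<close>.
\<close>

locale focus_zone =
  fixes T D a :: real
  assumes complex_eigenvalues: "T\<^sup>2 < 4 * D"
    and offset_nonzero: "a \<noteq> 0"
begin

definition freq :: real where
  "freq = sqrt (4 * D - T\<^sup>2) / 2"

text \<open>
  In coordinates centred at the equilibrium in which the flow is a complex exponential, this is
  the tangent of the direction in which \<open>(0, y)\<close> is seen.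
\<close>

definition slope :: "real \<Rightarrow> real" where
  "slope y = (D * y / a - T / 2) / freq"

text \<open>
  With polar coordinates \<open>r\<close>, \<open>\<theta>\<close> in the same frame, \<open>ln r + T / (2 freq) * \<theta>\<close> is constant along
  orbits; up to an additive constant this is its value at \<open>(0, y)\<close>.
\<close>

definition level :: "real \<Rightarrow> real" where
  "level y = ln (1 + (slope y)\<^sup>2) / 2 + T / (2 * freq) * arctan (slope y)"

text \<open>
  The squared distance of \<open>(0, y)\<close> from the equilibrium in the same frame, up to a constant factor.
\<close>

definition quad :: "real \<Rightarrow> real" where
  "quad y = D * y\<^sup>2 - a * T * y + a\<^sup>2"

text \<open>
  The arc from \<open>(0, u)\<close> to \<open>(0, - v)\<close> conserves the first integral. If the equilibrium is in the zone,
  the arc passes around it, and the polar angle at its end is one full turn behind the principal value that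
  enters \<open>level\<close>; the correction is that turn times \<open>T / (2 freq)\<close>.
\<close>

definition gap :: "real \<Rightarrow> real \<Rightarrow> real" where
  "gap u v = level (- v) - level u - (if a > 0 then 0 else pi * T / freq)"

lemma freq_pos: "freq > 0"
  using complex_eigenvalues by (simp add: freq_def)

lemma freq_sq: "freq\<^sup>2 = D - T\<^sup>2 / 4"
  using complex_eigenvalues by (simp add: freq_def power_divide)

lemma D_pos: "D > 0"
  using complex_eigenvalues zero_le_power2[of T] by linarith

lemma one_plus_slope_sq: "1 + (slope y)\<^sup>2 = D * quad y / (a * freq)\<^sup>2"
proof -
  have "(1 + (slope y)\<^sup>2) * (a * freq)\<^sup>2 = a\<^sup>2 * freq\<^sup>2 + (D * y - T / 2 * a)\<^sup>2"
    using freq_pos offset_nonzero by (simp add: slope_def field_simps power2_eq_square)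
  also have "\<dots> = D * quad y"
    unfolding freq_sq quad_def by (simp add: power2_eq_square algebra_simps)
  finally show ?thesis
    using freq_pos offset_nonzero by (simp add: field_simps)
qed

lemma quad_pos: "quad y > 0"
proof -
  have "D * quad y = (1 + (slope y)\<^sup>2) * (a * freq)\<^sup>2"
    unfolding one_plus_slope_sq using freq_pos offset_nonzero by simp
  also have "\<dots> > 0"
    using freq_pos offset_nonzero by (intro mult_pos_pos add_pos_nonneg) auto
  finally show ?thesis
    using D_pos by (simp add: zero_less_mult_iff)
qed

lemma level_deriv: "(level has_real_derivative D * y / quad y) (at y)"
proof -
  have p: "1 + (slope y)\<^sup>2 > 0"
    by (simp add: add_pos_nonneg)
  have slope: "(slope has_real_derivative D / (a * freq)) (at y)"
    unfolding slope_def [abs_def] using offset_nonzero freq_pos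
    by (auto intro!: derivative_eq_intros simp: field_simps)
  have outer: "((\<lambda>z. ln (1 + z\<^sup>2) / 2 + k * arctan z) has_real_derivative (z + k) / (1 + z\<^sup>2)) (at z)"
    if "1 + z\<^sup>2 > 0" for k z :: real
  proof -
    have "((\<lambda>z. ln (1 + z\<^sup>2)) has_real_derivative 2 * z / (1 + z\<^sup>2)) (at z)"
      using that by (auto intro!: derivative_eq_intros)
    from DERIV_add [OF DERIV_cdivide [OF this, of 2] DERIV_cmult [OF DERIV_arctan, of k]]
    have "((\<lambda>z. ln (1 + z\<^sup>2) / 2 + k * arctan z) has_real_derivative
        2 * z / (1 + z\<^sup>2) / 2 + k * inverse (1 + z\<^sup>2)) (at z)" .
    moreover have "2 * z / p / 2 + k * inverse p = (z + k) / p" for p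
      by (simp add: add_divide_distrib divide_inverse[of k])
    ultimately show ?thesis
      by (simp only:)
  qed
  have "(level has_real_derivative
      (slope y + T / (2 * freq)) / (1 + (slope y)\<^sup>2) * (D / (a * freq))) (at y)"
    unfolding level_def [abs_def] by (rule DERIV_chain2 [OF outer [OF p] slope])
  then have "(level has_real_derivative
      (slope y + T / (2 * freq)) * (D / (a * freq)) / (1 + (slope y)\<^sup>2)) (at y)"
    by (simp add: mult.commute)
  moreover have "slope y + T / (2 * freq) = D * y / (a * freq)"
    using freq_pos offset_nonzero by (simp add: slope_def field_simps)
  moreover have "D * y / (a * freq) * (D / (a * freq)) / (1 + (slope y)\<^sup>2) = D * y / quad y"
    unfolding one_plus_slope_sq using freq_pos offset_nonzero D_pos quad_pos[of y]
    by (simp add: field_simps power2_eq_square)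
  ultimately show ?thesis
    by simp
qed

lemma level_continuous: "continuous_on S level"
  by (meson DERIV_isCont continuous_at_imp_continuous_on level_deriv)

lemma level_strict_increasing: "level x < level y" if "0 \<le> x" "x < y"
proof (rule DERIV_pos_imp_increasing_open [OF \<open>x < y\<close>])
  fix t assume t: "x < t" "t < y"
  then show "\<exists>d. (level has_real_derivative d) (at t) \<and> d > 0"
    using level_deriv[of t] D_pos quad_pos[of t] that(1) by fastforce
qed (rule level_continuous)

lemma level_strict_decreasing: "level y < level x" if "x < y" "y \<le> 0"
proof (rule DERIV_neg_imp_decreasing_open [OF \<open>x < y\<close>])
  fix t assume t: "x < t" "t < y"
  then have "D * t / quad t < 0"
    using D_pos quad_pos[of t] that(2) by (simp add: divide_neg_pos mult_pos_neg)
  then show "\<exists>d. (level has_real_derivative d) (at t) \<and> d < 0"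
    using level_deriv[of t] by blast
qed (rule level_continuous)

lemma gap_less_first: "gap u' v < gap u v" if "0 \<le> u" "u < u'"
  using level_strict_increasing[OF that] by (simp add: gap_def)

lemma gap_less_second: "gap u v < gap u v'" if "0 \<le> v" "v < v'"
  using level_strict_decreasing[of "- v'" "- v"] that by (simp add: gap_def)

lemma gap_continuous_first: "continuous_on S (\<lambda>u. gap u v)"
  unfolding gap_def by (intro continuous_intros level_continuous)

lemma gap_continuous_second: "continuous_on S (\<lambda>v. gap u v)"
  unfolding gap_def
  by (intro continuous_intros continuous_on_compose2[OF level_continuous[of UNIV]]) auto

text \<open>
  An expanding arc around an equilibrium beyond the line leaves farther from the origin than it
  enters, because \<open>quad\<close> is smaller at \<open>t\<close> than at \<open>- t\<close>.
\<close>

lemma gap_diagonal_neg: "gap u u < 0" if "a > 0" "T > 0" "u > 0"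
proof -
  let ?f = "\<lambda>u. level (- u) - level u"
  have "?f u < ?f 0"
  proof (rule DERIV_neg_imp_decreasing_open [OF \<open>u > 0\<close>])
    fix t assume t: "0 < t" "t < u"
    have "((\<lambda>u. level (- u)) has_real_derivative D * (-t) / quad (- t) * - 1) (at t)"
      by (rule DERIV_chain2[OF level_deriv]) (auto intro!: derivative_eq_intros)
    then have "(?f has_real_derivative D * (-t) / quad (- t) * -1 - D * t / quad t) (at t)"
      by (intro derivative_intros level_deriv) auto
    moreover have "quad t < quad (- t)"
      using that t by (simp add: quad_def)
    then have "D * t / quad (- t) < D * t / quad t"
      using D_pos t quad_pos[of t] by (intro divide_strict_left_mono) auto
    ultimately have "(?f has_real_derivative D * t / quad (- t) - D * t / quad t) (at t)"
      and "D * t / quad (- t) - D * t / quad t < 0"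
      by simp_all
    then show "\<exists>d. (?f has_real_derivative d) (at t) \<and> d < 0"
      by blast
  qed (intro continuous_intros continuous_on_compose2[OF level_continuous[of UNIV]]; auto)
  then show ?thesis
    using that by (simp add: gap_def)
qed

lemma ln_slope_limit:
  assumes \<sigma>: "\<sigma> = 1 \<or> \<sigma> = -1"
  shows "((\<lambda>y. ln (1 + (slope (\<sigma> * y))\<^sup>2) / 2 - ln y) \<longlongrightarrow> ln (D / (\<bar>a\<bar> * freq))) at_top"
proof -
  have \<sigma>2: "\<sigma>\<^sup>2 = 1" and "\<sigma> \<noteq> 0"
    using \<sigma> by auto
  \<comment> \<open>The argument of the logarithm after division by \<open>y\<^sup>2\<close>, which absorbs \<open>ln y\<close>.\<close>
  have "((\<lambda>y. 1 / y\<^sup>2 + (D * \<sigma> / a / freq - T / 2 / freq / y)\<^sup>2)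
      \<longlongrightarrow> 0 + (D * \<sigma> / a / freq - 0)\<^sup>2) at_top"
    by (intro tendsto_intros tendsto_divide_0[OF tendsto_const]
        filterlim_at_top_imp_at_infinity filterlim_ident filterlim_pow_at_top) auto
  moreover have "(D * \<sigma> / a / freq)\<^sup>2 = (D / (\<bar>a\<bar> * freq))\<^sup>2"
    using \<sigma>2 by (simp add: power_mult_distrib power_divide)
  ultimately have "((\<lambda>y. 1 / y\<^sup>2 + (D * \<sigma> / a / freq - T / 2 / freq / y)\<^sup>2)
      \<longlongrightarrow> (D / (\<bar>a\<bar> * freq))\<^sup>2) at_top"
    by simp
  then have "((\<lambda>y. ln (1 / y\<^sup>2 + (D * \<sigma> / a / freq - T / 2 / freq / y)\<^sup>2) / 2)
      \<longlongrightarrow> ln ((D / (\<bar>a\<bar> * freq))\<^sup>2) / 2) at_top"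
    using D_pos freq_pos offset_nonzero by (intro tendsto_intros) auto
  moreover have "ln ((D / (\<bar>a\<bar> * freq))\<^sup>2) / 2 = ln (D / (\<bar>a\<bar> * freq))"
    using D_pos freq_pos offset_nonzero by (simp add: ln_realpow)
  ultimately have "((\<lambda>y. ln (1 / y\<^sup>2 + (D * \<sigma> / a / freq - T / 2 / freq / y)\<^sup>2) / 2)
      \<longlongrightarrow> ln (D / (\<bar>a\<bar> * freq))) at_top"
    by simp
  then show ?thesis
  proof (rule Lim_transform_eventually)
    show "\<forall>\<^sub>F y in at_top. ln (1 / y\<^sup>2 + (D * \<sigma> / a / freq - T / 2 / freq / y)\<^sup>2) / 2
      = ln (1 + (slope (\<sigma> * y))\<^sup>2) / 2 - ln y"
  proof (rule eventually_mono[OF eventually_gt_at_top[of 0]])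
    fix y :: real assume y: "0 < y"
    have p: "1 + (slope (\<sigma> * y))\<^sup>2 > 0"
      by (simp add: add_pos_nonneg)
    have "slope (\<sigma> * y) / y = D * \<sigma> / a / freq - T / 2 / freq / y"
      using y offset_nonzero freq_pos by (simp add: slope_def field_simps)
    then have "1 / y\<^sup>2 + (D * \<sigma> / a / freq - T / 2 / freq / y)\<^sup>2 = (1 + (slope (\<sigma> * y))\<^sup>2) / y\<^sup>2"
      unfolding add_divide_distrib power_divide[symmetric] by simp
    then show "ln (1 / y\<^sup>2 + (D * \<sigma> / a / freq - T / 2 / freq / y)\<^sup>2) / 2
      = ln (1 + (slope (\<sigma> * y))\<^sup>2) / 2 - ln y"
      using y p by (simp add: ln_div ln_realpow)
    qed
  qed
qed

lemma arctan_slope_limit: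
  assumes \<sigma>: "\<sigma> = 1 \<or> \<sigma> = -1"
  shows "((\<lambda>y. arctan (slope (\<sigma> * y))) \<longlongrightarrow> \<sigma> * sgn a * (pi / 2)) at_top"
proof -
  have *: "filterlim (\<lambda>y. c * y + b) at_top at_top" if "c > 0" for c b :: real
    using that by (simp add: filterlim_tendsto_add_at_top[OF tendsto_const] filterlim_ident
        filterlim_tendsto_pos_mult_at_top[OF tendsto_const] add.commute[of _ b])
  have eq: "slope (\<sigma> * y) = (D * \<sigma> / (a * freq)) * y + (- T / 2 / freq)" for y
    using offset_nonzero freq_pos by (simp add: slope_def field_simps)
  show ?thesis
  proof (cases "\<sigma> * a > 0")
    case True
    then have "D * \<sigma> / (a * freq) > 0"
      using D_pos freq_pos \<sigma> by (auto simp: zero_less_mult_iff zero_less_divide_iff divide_less_0_iff mult_less_0_iff)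
    moreover have "\<sigma> * sgn a = 1"
      using True \<sigma> by (auto simp: sgn_if zero_less_mult_iff)
    ultimately show ?thesis
      unfolding eq using filterlim_compose[OF tendsto_arctan_at_top *, of "D * \<sigma> / (a * freq)" "- T / 2 / freq"]
      by simp
  next
    case False
    then have neg: "\<sigma> * a < 0"
      using \<sigma> offset_nonzero by auto
    then have "- (D * \<sigma> / (a * freq)) > 0"
      using D_pos freq_pos \<sigma> by (auto simp: zero_less_mult_iff zero_less_divide_iff divide_less_0_iff mult_less_0_iff)
    from filterlim_compose[OF tendsto_arctan_at_top *[OF this, of "T / 2 / freq"]]
    have "((\<lambda>y. - arctan (slope (\<sigma> * y))) \<longlongrightarrow> pi / 2) at_top"
      unfolding eq arctan_minus[symmetric] by (simp add: algebra_simps)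
    from tendsto_minus[OF this] show ?thesis
      using neg \<sigma> by (auto simp: sgn_if mult_less_0_iff)
  qed
qed

lemma level_limit:
  assumes \<sigma>: "\<sigma> = 1 \<or> \<sigma> = -1"
  shows "((\<lambda>y. level (\<sigma> * y) - ln y) \<longlongrightarrow>
    ln (D / (\<bar>a\<bar> * freq)) + \<sigma> * sgn a * (pi * T / (4 * freq))) at_top"
proof -
  have "((\<lambda>y. (ln (1 + (slope (\<sigma> * y))\<^sup>2) / 2 - ln y) + T / (2 * freq) * arctan (slope (\<sigma> * y)))
      \<longlongrightarrow> ln (D / (\<bar>a\<bar> * freq)) + T / (2 * freq) * (\<sigma> * sgn a * (pi / 2))) at_top"
    by (intro tendsto_intros ln_slope_limit[OF \<sigma>] arctan_slope_limit[OF \<sigma>])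
  then show ?thesis
    by (simp add: level_def algebra_simps)
qed

text \<open>
  Far from the origin the arc is a half-turn, whatever the sign of \<open>a\<close>, and the ratio \<open>v / u\<close> of a zero
  approaches the expansion factor of a half-turn.
\<close>

lemma gap_limit:
  assumes "filterlim u at_top F" "filterlim v at_top F"
  shows "((\<lambda>x. gap (u x) (v x) - (ln (v x) - ln (u x))) \<longlongrightarrow> - (pi * T / (2 * freq))) F"
proof -
  let ?c = "if a > 0 then 0 else pi * T / freq"
  have "((\<lambda>x. (level (-1 * v x) - ln (v x)) - (level (1 * u x) - ln (u x)) - ?c) \<longlongrightarrow>
      (ln (D / (\<bar>a\<bar> * freq)) + -1 * sgn a * (pi * T / (4 * freq))) -
      (ln (D / (\<bar>a\<bar> * freq)) + 1 * sgn a * (pi * T / (4 * freq))) - ?c) F"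
    by (intro tendsto_diff tendsto_const
        filterlim_compose[OF level_limit assms(2)] filterlim_compose[OF level_limit assms(1)]) auto
  moreover have "(ln (D / (\<bar>a\<bar> * freq)) + -1 * sgn a * (pi * T / (4 * freq))) -
      (ln (D / (\<bar>a\<bar> * freq)) + 1 * sgn a * (pi * T / (4 * freq))) - ?c = - (pi * T / (2 * freq))"
    using offset_nonzero by (cases "a > 0") (simp_all add: sgn_if)
  moreover have "(level (-1 * v x) - ln (v x)) - (level (1 * u x) - ln (u x)) - ?c
      = gap (u x) (v x) - (ln (v x) - ln (u x))" for x
    by (simp add: gap_def)
  ultimately show ?thesis
    by (simp only:)
qed

end

lemma focus_zone_reverse: "focus_zone (- T) D a" if "focus_zone T D a"
  using that by (simp add: focus_zone_def)

lemma gap_reverse: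
  assumes "focus_zone T D a"
  shows "focus_zone.gap (- T) D a u v = - focus_zone.gap T D a v u"
proof -
  interpret P: focus_zone T D a by fact
  interpret N: focus_zone "- T" D a using assms by (rule focus_zone_reverse)
  have f: "N.freq = P.freq"
    by (simp add: N.freq_def P.freq_def)
  then have "N.slope y = - P.slope (- y)" for y
    using P.offset_nonzero P.freq_pos by (simp add: N.slope_def P.slope_def field_simps)
  then have "N.level y = P.level (- y)" for y
    by (simp add: N.level_def P.level_def f arctan_minus)
  then show ?thesis
    by (simp add: N.gap_def P.gap_def f)
qed

section \<open>Isolated common zeros of two gaps\<close>

context focus_zone
begin

lemma level_unbounded: "filterlim (\<lambda>v. level (- v)) at_top at_top"
proof -
  have "filterlim (\<lambda>v. (level (- 1 * v) - ln v) + ln v) at_top at_top"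
    by (rule filterlim_tendsto_add_at_top [OF level_limit ln_at_top]) simp
  then show ?thesis
    by simp
qed

lemma level_negative_onto:
  assumes "l > level 0"
  obtains v where "v > 0" "level (- v) = l"
proof -
  have "\<forall>\<^sub>F v in at_top. level (- v) \<ge> l \<and> v > 0"
    using level_unbounded eventually_gt_at_top by (auto simp: filterlim_at_top eventually_conj_iff)
  then obtain w where w: "level (- w) \<ge> l" "w > 0"
    by (metis (no_types, lifting) eventually_at_top_linorder order_refl)
  have "continuous_on {0..w} (\<lambda>v. level (- v))"
    by (intro continuous_on_compose2 [OF level_continuous [of UNIV]] continuous_intros) auto
  then obtain v where v: "0 \<le> v" "level (- v) = l"
    using IVT' [of "\<lambda>v. level (- v)" 0 l w] w assms by auto
  then have "v \<noteq> 0"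
    using assms by auto
  then show ?thesis
    using v by (intro that [of v]) auto
qed

lemma level_negative_deriv: "((\<lambda>v. level (- v)) has_real_derivative D * v / quad (- v)) (at v)"
proof -
  have "((\<lambda>v. level (- v)) has_real_derivative D * (- v) / quad (- v) * - 1) (at v)"
    by (rule DERIV_chain2 [OF level_deriv]) (auto intro!: derivative_eq_intros)
  then show ?thesis
    by simp
qed

text \<open>
  The inverse of \<open>\<lambda>v. level (- v)\<close> on the positive reals.
\<close>

definition exit_depth :: "real \<Rightarrow> real" where
  "exit_depth l = (SOME v. v > 0 \<and> level (- v) = l)"

lemma exit_depth:
  assumes "l > level 0"
  shows "exit_depth l > 0" "level (- exit_depth l) = l"
proof -
  have "\<exists>v. v > 0 \<and> level (- v) = l"
    using level_negative_onto [OF assms] by blast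
  then have "exit_depth l > 0 \<and> level (- exit_depth l) = l"
    unfolding exit_depth_def by (rule someI_ex)
  then show "exit_depth l > 0" "level (- exit_depth l) = l"
    by auto
qed

lemma level_negative_inj: "v = w" if "level (- v) = level (- w)" "v > 0" "w > 0"
  using level_strict_decreasing [of "- v" "- w"] level_strict_decreasing [of "- w" "- v"] that
  by (cases v w rule: linorder_cases) auto

lemma exit_depth_level: "exit_depth (level (- v)) = v" if "v > 0"
proof -
  have "level 0 < level (- v)"
    using level_strict_decreasing [of "- v" 0] that by simp
  from exit_depth [OF this] show ?thesis
    using level_negative_inj that by simp
qed

lemma exit_depth_deriv:
  assumes l: "l > level 0"
  shows "(exit_depth has_real_derivative quad (- exit_depth l) / (D * exit_depth l)) (at l)"
proof -
  let ?x = "exit_depth l"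
  note x = exit_depth [OF l]
  have "isCont exit_depth (level (- ?x))"
    by (rule isCont_inverse_function2 [of "?x / 2" ?x "2 * ?x" exit_depth "\<lambda>v. level (- v)"])
      (use x(1) exit_depth_level in \<open>auto intro: DERIV_isCont [OF level_negative_deriv]\<close>)
  then have cont: "isCont exit_depth l"
    by (simp add: x)
  have "D * ?x / quad (- ?x) \<noteq> 0"
    using D_pos x(1) quad_pos [of "- ?x"] by simp
  then have "(exit_depth has_real_derivative inverse (D * ?x / quad (- ?x))) (at l)"
    by (rule DERIV_inverse_function [where f = "\<lambda>v. level (- v)" and a = "level 0" and b = "l + 1",
          OF level_negative_deriv _ l _ exit_depth(2) cont]) auto
  then show ?thesis
    by (simp add: inverse_eq_divide)
qed

end

lemma nonzero_near_simple_zero: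
  fixes f :: "real \<Rightarrow> real"
  assumes f: "(f has_real_derivative d) (at x)" and "f x = 0 \<Longrightarrow> d \<noteq> 0"
  shows "\<forall>\<^sub>F y in at x. f y \<noteq> 0"
proof (cases "f x = 0")
  case True
  have "((\<lambda>y. (f y - f x) / (y - x)) \<longlongrightarrow> d) (at x)"
    using f by (simp add: has_field_derivative_iff)
  then have "\<forall>\<^sub>F y in at x. (f y - f x) / (y - x) \<noteq> 0"
    using assms(2) True by (intro tendsto_imp_eventually_ne)
  then show ?thesis
    by (rule eventually_mono) (auto simp: True)
next
  case False
  have "(f \<longlongrightarrow> f x) (at x)"
    using DERIV_isCont [OF f] by (simp add: isCont_def)
  then show ?thesis
    using False by (rule tendsto_imp_eventually_ne)
qed

text \<open>
  Isolation in the plane, rather than in the first coordinate, keeps the notion symmetric under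
  interchanging the coordinates.
\<close>

definition isolated_common_zero :: "(real \<Rightarrow> real \<Rightarrow> real) \<Rightarrow> (real \<Rightarrow> real \<Rightarrow> real) \<Rightarrow> real \<Rightarrow> real \<Rightarrow> bool" where
  "isolated_common_zero F G u v \<longleftrightarrow> u > 0 \<and> v > 0 \<and> F u v = 0 \<and> G u v = 0 \<and>
     (\<exists>\<epsilon>>0. \<forall>u' v'. \<bar>u' - u\<bar> < \<epsilon> \<and> \<bar>v' - v\<bar> < \<epsilon> \<and> F u' v' = 0 \<and> G u' v' = 0 \<longrightarrow> u' = u \<and> v' = v)"

text \<open>
  Up to reversal of time and interchange of the two zones, this is the general case of a pair of zones
  whose traces have the same sign, which do not both contain their equilibrium, and for which \<open>\<xi> * cinf\<close>
  is positive. With the first equilibrium beyond the line, an arc leaves from every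
  height \<open>u > 0\<close>. The last condition says that far away the first zone expands more than the second one.
\<close>

locale zone_pair =
  one: focus_zone T1 D1 a1 + two: focus_zone T2 D2 a2 for T1 D1 a1 T2 D2 a2 :: real +
  assumes virtual: "a1 > 0" and expanding: "T1 > 0" "T2 > 0"
    and \<xi>_pos: "a1 * T2 - a2 * T1 > 0" and outward: "T2\<^sup>2 * D1 < T1\<^sup>2 * D2"
begin

definition depth :: "real \<Rightarrow> real" where
  "depth u = one.exit_depth (one.level u)"

lemma level_gt: "u > 0 \<Longrightarrow> one.level 0 < one.level u"
  using one.level_strict_increasing [of 0 u] by simp

lemma depth_pos: "u > 0 \<Longrightarrow> depth u > 0"
  unfolding depth_def by (intro one.exit_depth level_gt)

lemma one_gap_iff: "one.gap u v = 0 \<longleftrightarrow> v = depth u" if "u > 0" "v > 0"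
  using one.exit_depth [OF level_gt [OF that(1)]] one.level_negative_inj [of v "depth u"] that virtual
  by (auto simp: one.gap_def depth_def)

lemma depth_gt: "depth u > u" if "u > 0"
proof (rule ccontr)
  assume "\<not> u < depth u"
  then have "one.gap u (depth u) \<le> one.gap u u"
    using one.gap_less_second [of "depth u" u u] depth_pos [OF that] by (cases "depth u = u") auto
  then show False
    using one_gap_iff [OF that depth_pos [OF that]] one.gap_diagonal_neg [OF virtual expanding(1) that] by simp
qed

lemma depth_small:
  assumes "\<epsilon> > 0"
  obtains \<delta> where "\<delta> > 0" "\<And>u. \<lbrakk>0 < u; u < \<delta>\<rbrakk> \<Longrightarrow> depth u < \<epsilon>"
proof -
  have "one.gap 0 0 < one.gap 0 \<epsilon>"
    using assms by (intro one.gap_less_second) auto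
  then have "one.gap 0 \<epsilon> > 0"
    using virtual by (simp add: one.gap_def)
  moreover have "isCont (\<lambda>u. one.gap u \<epsilon>) 0"
    using one.gap_continuous_first [of UNIV \<epsilon>] by (simp add: continuous_on_eq_continuous_at)
  ultimately have "\<forall>\<^sub>F u in at 0. one.gap u \<epsilon> > 0"
    by (simp add: isCont_def order_tendsto_iff)
  then obtain \<delta> where \<delta>: "\<delta> > 0" "\<And>u. u \<noteq> 0 \<Longrightarrow> dist u 0 < \<delta> \<Longrightarrow> one.gap u \<epsilon> > 0"
    unfolding eventually_at by auto
  show ?thesis
  proof (rule that [OF \<delta>(1)])
    fix u assume u: "0 < u" "u < \<delta>"
    show "depth u < \<epsilon>"
    proof (rule ccontr)
      assume "\<not> depth u < \<epsilon>"
      then have "one.gap u \<epsilon> \<le> one.gap u (depth u)"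
        using one.gap_less_second [of \<epsilon> "depth u" u] assms by (cases "depth u = \<epsilon>") auto
      then show False
        using \<delta>(2) [of u] u one_gap_iff [OF u(1) depth_pos [OF u(1)]] by simp
    qed
  qed
qed

lemma depth_deriv:
  assumes "u > 0"
  shows "(depth has_real_derivative u * one.quad (- depth u) / (depth u * one.quad u)) (at u)"
proof -
  have "(depth has_real_derivative
      one.quad (- depth u) / (D1 * depth u) * (D1 * u / one.quad u)) (at u)"
    unfolding depth_def by (rule DERIV_chain2 [OF one.exit_depth_deriv one.level_deriv]) (rule level_gt [OF assms])
  then show ?thesis
    using one.D_pos by (simp add: mult_ac)
qed

text \<open>
  The zeros of this function are the common zeros of the two gaps.
\<close>

definition mismatch :: "real \<Rightarrow> real" where
  "mismatch u = two.gap u (depth u)"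

text \<open>
  The quotient by \<open>x - y\<close> of the determinant of the values of the two quadratics at \<open>x\<close> and \<open>y\<close>. It vanishes at
  \<open>x \<noteq> y\<close> exactly when a non-trivial linear combination of the quadratics has both \<open>x\<close> and \<open>y\<close> as roots.
\<close>

definition pencil :: "real \<Rightarrow> real \<Rightarrow> real" where
  "pencil x y = (D2 * a1\<^sup>2 - D1 * a2\<^sup>2) * (x + y) - a1 * a2 * (a1 * T2 - a2 * T1)
     + (D1 * a2 * T2 - D2 * a1 * T1) * (x * y)"

lemma quad_cross_difference:
  "one.quad y * two.quad x - one.quad x * two.quad y = (x - y) * pencil x y"
  by (simp add: one.quad_def two.quad_def pencil_def algebra_simps power2_eq_square)

text \<open>
  On the zero set of \<open>pencil\<close> the second variable is a Moebius involution of the first; this is the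
  transformation rule of the quadratics under that involution.
\<close>

lemma quad_ratio:
  "one.quad y * (D2 * a1\<^sup>2 - D1 * a2\<^sup>2 + (D1 * a2 * T2 - D2 * a1 * T1) * x)
    - one.quad x * (D2 * a1\<^sup>2 - D1 * a2\<^sup>2 + (D1 * a2 * T2 - D2 * a1 * T1) * y)
    = D1 * (y - x) * pencil x y"
  by (simp add: one.quad_def pencil_def algebra_simps power2_eq_square)

lemma mismatch_deriv:
  assumes u: "u > 0"
  shows "(mismatch has_real_derivative
    D2 * u * (u + depth u) / (one.quad u * two.quad u * two.quad (- depth u)) * pencil u (- depth u)) (at u)"
proof -
  let ?v = "depth u"
  have v: "?v > 0"
    using u by (rule depth_pos)
  have "((\<lambda>u. two.level (- depth u)) has_real_derivative
      D2 * ?v / two.quad (- ?v) * (u * one.quad (- ?v) / (?v * one.quad u))) (at u)"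
    by (rule DERIV_chain2 [OF two.level_negative_deriv depth_deriv [OF u]])
  then have "(mismatch has_real_derivative
      D2 * ?v / two.quad (- ?v) * (u * one.quad (- ?v) / (?v * one.quad u)) - D2 * u / two.quad u - 0) (at u)"
    unfolding mismatch_def [abs_def] two.gap_def
    by (intro DERIV_diff two.level_deriv DERIV_const)
  moreover have "D2 * ?v / two.quad (- ?v) * (u * one.quad (- ?v) / (?v * one.quad u)) - D2 * u / two.quad u - 0
     = D2 * u / (one.quad u * two.quad u * two.quad (- ?v))
       * (one.quad (- ?v) * two.quad u - one.quad u * two.quad (- ?v))"
    using v one.quad_pos [of u] two.quad_pos [of u] two.quad_pos [of "- ?v"] by (simp add: field_simps)
  ultimately show ?thesis
    unfolding quad_cross_difference by (simp add: mult_ac)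
qed

text \<open>
  At a zero of \<open>pencil\<close> along the graph of \<open>depth\<close>, the ratio of the quadratics in the derivative of
  \<open>depth\<close> is the ratio of two linear forms, and the derivative of \<open>pencil\<close> collapses to a non-zero
  multiple of \<open>depth u - u\<close>. So the zero is simple.
\<close>

lemma pencil_nonzero_nearby:
  assumes u: "u > 0"
  shows "\<forall>\<^sub>F x in at u. pencil x (- depth x) \<noteq> 0"
proof -
  define A where "A = D2 * a1\<^sup>2 - D1 * a2\<^sup>2"
  define B where "B = D1 * a2 * T2 - D2 * a1 * T1"
  define C where "C = - (a1 * a2 * (a1 * T2 - a2 * T1))"
  have C: "C \<noteq> 0"
    using one.offset_nonzero two.offset_nonzero \<xi>_pos by (simp add: C_def)
  have pencil: "pencil x y = A * (x + y) + C + B * (x * y)" for x y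
    by (simp add: pencil_def A_def B_def C_def)
  let ?v = "depth u"
  have v: "?v > u" "?v > 0"
    using depth_gt [OF u] depth_pos [OF u] by auto
  define v' where "v' = u * one.quad (- ?v) / (?v * one.quad u)"
  have "((\<lambda>x. A * (x + - depth x) + C + B * (x * - depth x)) has_real_derivative
      A * (1 - v') + B * (- ?v - u * v')) (at u)"
    using depth_deriv [OF u, folded v'_def]
    by (auto intro!: derivative_eq_intros simp: algebra_simps)
  moreover have "A * (1 - v') + B * (- ?v - u * v') \<noteq> 0" if zero: "A * (u + - ?v) + C + B * (u * - ?v) = 0"
  proof -
    define s where "s = A + B * u"
    define t where "t = A - B * ?v"
    have ratio: "one.quad (- ?v) * s = one.quad u * t"
      using quad_ratio [of "- ?v" u] zero by (simp add: pencil s_def t_def A_def B_def)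
    \<comment> \<open>If \<open>s\<close> and hence \<open>t\<close> vanished, \<open>pencil\<close> would be the constant \<open>C\<close>.\<close>
    have "s \<noteq> 0"
    proof
      assume "s = 0"
      then have "t = 0"
        using ratio one.quad_pos [of u] by simp
      then have "B * (u + ?v) = 0"
        using \<open>s = 0\<close> by (simp add: s_def t_def algebra_simps)
      then have "B = 0"
        using u v by simp
      then have "A = 0"
        using \<open>s = 0\<close> by (simp add: s_def)
      then show False
        using zero C \<open>B = 0\<close> by simp
    qed
    then have "t \<noteq> 0"
      using ratio one.quad_pos [of "- ?v"] by auto
    have "one.quad (- ?v) / one.quad u = t / s"
      using ratio \<open>s \<noteq> 0\<close> one.quad_pos [of u] by (simp add: field_simps)
    moreover have "v' = u / ?v * (one.quad (- ?v) / one.quad u)"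
      by (simp add: v'_def)
    ultimately have v': "v' = u / ?v * (t / s)"
      by simp
    have "A * (1 - v') + B * (- ?v - u * v') = t - s * v'"
      by (simp add: s_def t_def algebra_simps)
    also have "\<dots> = t * (?v - u) / ?v"
      unfolding v' using \<open>s \<noteq> 0\<close> v by (simp add: field_simps)
    finally show ?thesis
      using \<open>t \<noteq> 0\<close> v by simp
  qed
  ultimately show ?thesis
    unfolding pencil by (rule nonzero_near_simple_zero)
qed

lemma mismatch_continuous: "continuous_on S mismatch" if "S \<subseteq> {0<..}"
  using that DERIV_isCont [OF mismatch_deriv] by (intro continuous_at_imp_continuous_on) auto

text \<open>
  If the second zone contains its equilibrium, its arcs from low heights end at a definite depth,
  while \<open>depth u\<close> tends to zero. Otherwise both arcs shrink to the origin, \<open>mismatch\<close> tends to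
  zero there, and it decreases because \<open>pencil 0 0 < 0\<close>.
\<close>

lemma mismatch_negative_somewhere:
  obtains u where "u > 0" "mismatch u < 0"
proof (cases "a2 > 0")
  case False
  then have "two.gap 0 0 < 0"
    using expanding two.freq_pos by (simp add: two.gap_def)
  moreover have "isCont (\<lambda>v. two.gap 0 v) 0"
    using two.gap_continuous_second [of UNIV 0] by (simp add: continuous_on_eq_continuous_at)
  ultimately have "\<forall>\<^sub>F v in at 0. two.gap 0 v < 0"
    by (simp add: isCont_def order_tendsto_iff)
  then obtain d where d: "d > 0" "\<And>v. v \<noteq> 0 \<Longrightarrow> dist v 0 < d \<Longrightarrow> two.gap 0 v < 0"
    unfolding eventually_at by auto
  obtain \<delta> where \<delta>: "\<delta> > 0" "\<And>u. \<lbrakk>0 < u; u < \<delta>\<rbrakk> \<Longrightarrow> depth u < d"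
    by (rule depth_small [OF d(1)]) blast
  let ?u = "\<delta> / 2"
  have u: "?u > 0" "depth ?u < d"
    using \<delta>(1) \<delta>(2) [of ?u] by auto
  have "two.gap ?u (depth ?u) < two.gap 0 (depth ?u)"
    using u by (intro two.gap_less_first) auto
  also have "\<dots> < 0"
    using u depth_pos [of ?u] by (intro d(2)) auto
  finally have "mismatch ?u < 0"
    by (simp add: mismatch_def)
  with u(1) show ?thesis
    by (rule that)
next
  case True
  have c: "a1 * a2 * (a1 * T2 - a2 * T1) > 0"
    using True virtual \<xi>_pos by simp
  have "isCont (\<lambda>p. pencil (fst p) (- snd p)) (0, 0)"
    unfolding pencil_def by (intro continuous_intros)
  moreover have "pencil (fst (0, 0)) (- snd (0, 0)) < 0"
    using c by (simp add: pencil_def)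
  ultimately have "\<forall>\<^sub>F p in at (0, 0). pencil (fst p) (- snd p) < 0"
    unfolding isCont_def by (rule order_tendstoD)
  then obtain d where d: "d > 0" "\<And>p. p \<noteq> (0, 0) \<Longrightarrow> dist p (0, 0) < d \<Longrightarrow> pencil (fst p) (- snd p) < 0"
    unfolding eventually_at by auto
  obtain \<delta> where \<delta>: "\<delta> > 0" "\<And>u. \<lbrakk>0 < u; u < \<delta>\<rbrakk> \<Longrightarrow> depth u < d / 2"
    using depth_small [of "d / 2"] d(1) by auto
  define r where "r = min \<delta> d / 2"
  have r: "r > 0" "r < \<delta>" "r \<le> d / 2"
    using \<delta>(1) d(1) by (auto simp: r_def)
  have pencil_neg: "pencil u (- depth u) < 0" if "0 < u" "u \<le> r" for u
  proof -
    have "dist (u, depth u) (0, 0) \<le> \<bar>u\<bar> + \<bar>depth u\<bar>"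
      using norm_Pair_le [of u "depth u"] by (simp add: dist_norm)
    also have "\<dots> < d"
      using that r \<delta>(2) [of u] depth_pos [of u] by simp
    finally show ?thesis
      using d(2) [of "(u, depth u)"] that by simp
  qed
  have decreasing: "mismatch y < mismatch x" if "0 < x" "x < y" "y \<le> r" for x y
  proof (rule DERIV_neg_imp_decreasing [OF that(2)])
    fix u assume u: "x \<le> u" "u \<le> y"
    then have u': "0 < u" "u \<le> r"
      using that by auto
    have "D2 * u * (u + depth u) / (one.quad u * two.quad u * two.quad (- depth u)) > 0"
      using u' depth_pos [of u] two.D_pos one.quad_pos two.quad_pos by simp
    then show "\<exists>d. (mismatch has_real_derivative d) (at u) \<and> d < 0"
      using mismatch_deriv [OF u'(1)] pencil_neg [OF u'] mult_pos_neg by blast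
  qed
  \<comment> \<open>If \<open>mismatch r\<close> were non-negative, \<open>mismatch\<close> would stay above \<open>\<eta>\<close> near zero, where it is small.\<close>
  define \<eta> where "\<eta> = mismatch (r / 2) - mismatch r"
  have \<eta>: "\<eta> > 0"
    using decreasing [of "r / 2" r] r by (simp add: \<eta>_def)
  have "two.gap 0 0 = 0"
    using True by (simp add: two.gap_def)
  moreover have "isCont (\<lambda>v. two.gap 0 v) 0"
    using two.gap_continuous_second [of UNIV 0] by (simp add: continuous_on_eq_continuous_at)
  ultimately have "\<forall>\<^sub>F v in at 0. two.gap 0 v < \<eta>"
    using \<eta> by (simp add: isCont_def order_tendsto_iff)
  then obtain e where e: "e > 0" "\<And>v. v \<noteq> 0 \<Longrightarrow> dist v 0 < e \<Longrightarrow> two.gap 0 v < \<eta>"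
    unfolding eventually_at by auto
  obtain \<delta>' where \<delta>': "\<delta>' > 0" "\<And>u. \<lbrakk>0 < u; u < \<delta>'\<rbrakk> \<Longrightarrow> depth u < e"
    by (rule depth_small [OF e(1)]) blast
  define u where "u = min \<delta>' (r / 2) / 2"
  have u: "0 < u" "u < \<delta>'" "u < r / 2"
    using \<delta>'(1) r by (auto simp: u_def)
  have "mismatch u < two.gap 0 (depth u)"
    unfolding mismatch_def using u depth_pos [of u] by (intro two.gap_less_first) auto
  also have "\<dots> < \<eta>"
    using u depth_pos [of u] \<delta>'(2) [of u] by (intro e(2)) auto
  finally have "mismatch (r / 2) < \<eta>"
    using decreasing [of u "r / 2"] u r by simp
  then have "mismatch r < 0"
    by (simp add: \<eta>_def)
  then show ?thesis
    using r that by blast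
qed

text \<open>
  Subtracting the first gap, which vanishes along the graph, cancels the logarithms in both asymptotic
  expansions; the difference of the two constants is positive by the last condition of the locale.
\<close>

lemma mismatch_eventually_positive: "\<forall>\<^sub>F u in at_top. mismatch u > 0"
proof -
  have depth_top: "filterlim depth at_top at_top"
    by (rule filterlim_at_top_mono [OF filterlim_ident])
      (auto intro!: eventually_mono [OF eventually_gt_at_top [of 0]] less_imp_le depth_gt)
  have "((\<lambda>u. (two.gap u (depth u) - (ln (depth u) - ln u)) - (one.gap u (depth u) - (ln (depth u) - ln u)))
      \<longlongrightarrow> - (pi * T2 / (2 * two.freq)) - - (pi * T1 / (2 * one.freq))) at_top"
    by (intro tendsto_diff two.gap_limit one.gap_limit filterlim_ident depth_top)
  moreover have "- (pi * T2 / (2 * two.freq)) - - (pi * T1 / (2 * one.freq)) > 0"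
  proof -
    have "(T2 * one.freq)\<^sup>2 < (T1 * two.freq)\<^sup>2"
      using outward by (simp add: power_mult_distrib one.freq_sq two.freq_sq algebra_simps)
    then have "T2 * one.freq < T1 * two.freq"
      using expanding two.freq_pos by (elim power2_less_imp_less) simp
    then have "pi * (T2 * one.freq) < pi * (T1 * two.freq)"
      by simp
    then have "pi * T2 / (2 * two.freq) < pi * T1 / (2 * one.freq)"
      using one.freq_pos two.freq_pos by (simp add: divide_simps mult_ac)
    then show ?thesis
      by simp
  qed
  ultimately have "\<forall>\<^sub>F u in at_top. (two.gap u (depth u) - (ln (depth u) - ln u)) -
      (one.gap u (depth u) - (ln (depth u) - ln u)) > 0"
    by (rule order_tendstoD)
  then show ?thesis
  proof (rule eventually_elim2 [OF _ eventually_gt_at_top [of 0]])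
    fix u :: real
    assume u: "0 < u" and "(two.gap u (depth u) - (ln (depth u) - ln u)) -
      (one.gap u (depth u) - (ln (depth u) - ln u)) > 0"
    then show "mismatch u > 0"
      using one_gap_iff [OF u depth_pos [OF u]] by (simp add: mismatch_def)
  qed
qed

lemma exists_isolated_common_zero: "\<exists>u v. isolated_common_zero one.gap two.gap u v"
proof -
  obtain u0 where u0: "u0 > 0" "mismatch u0 < 0"
    by (rule mismatch_negative_somewhere)
  obtain u1 where u1: "u1 \<ge> u0" "mismatch u1 > 0"
    using eventually_happens [OF eventually_conj [OF mismatch_eventually_positive eventually_ge_at_top [of u0]]]
    by auto
  have "continuous_on {u0..u1} mismatch"
    using u0 by (intro mismatch_continuous) auto
  then obtain u where u: "u0 \<le> u" "mismatch u = 0"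
    using IVT' [of mismatch u0 0 u1] u0 u1 by auto
  have u_pos: "u > 0"
    using u u0 by simp
  obtain d where d: "d > 0" "\<And>x. x \<noteq> u \<Longrightarrow> dist x u < d \<Longrightarrow> pencil x (- depth x) \<noteq> 0"
    using pencil_nonzero_nearby [OF u_pos] unfolding eventually_at by auto
  \<comment> \<open>Rolle's theorem between two zeros produces a zero of \<open>pencil\<close> too close to \<open>u\<close>.\<close>
  have no_zero_between: False
    if xy: "0 < x" "x < y" "mismatch x = 0" "mismatch y = 0" and near: "\<And>z. x < z \<Longrightarrow> z < y \<Longrightarrow> z \<noteq> u \<and> dist z u < d" for x y
  proof -
    have "continuous_on {x..y} mismatch"
      using xy by (intro mismatch_continuous) auto
    moreover have "mismatch differentiable (at z)" if "x < z" "z < y" for z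
      using mismatch_deriv [of z] that xy by (auto simp: real_differentiable_def)
    ultimately obtain z where z: "x < z" "z < y" "(mismatch has_real_derivative 0) (at z)"
      using Rolle [of x y mismatch] xy by auto
    have zp: "0 < z"
      using z xy by simp
    have "D2 * z * (z + depth z) / (one.quad z * two.quad z * two.quad (- depth z)) \<noteq> 0"
      using zp depth_pos [OF zp] two.D_pos one.quad_pos [of z] two.quad_pos [of z] two.quad_pos [of "- depth z"]
      by simp
    then have "pencil z (- depth z) = 0"
      using DERIV_unique [OF mismatch_deriv [OF zp] z(3)] by (simp only: mult_eq_0_iff) simp
    then show False
      using d(2) [of z] near [OF z(1,2)] by simp
  qed
  have isolated: "x = u" if "0 < x" "\<bar>x - u\<bar> < d" "mismatch x = 0" for x
    using no_zero_between [of x u] no_zero_between [of u x] that u u_pos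
    by (cases x u rule: linorder_cases) (auto simp: dist_real_def)
  have "isolated_common_zero one.gap two.gap u (depth u)"
    unfolding isolated_common_zero_def
  proof (intro conjI exI [of _ "min d (min u (depth u))"] allI impI; (elim conjE)?)
    show "one.gap u (depth u) = 0"
      using one_gap_iff u_pos depth_pos by simp
    show "two.gap u (depth u) = 0"
      using u by (simp add: mismatch_def)
    fix u' v' assume near: "\<bar>u' - u\<bar> < min d (min u (depth u))" "\<bar>v' - depth u\<bar> < min d (min u (depth u))"
      and zero: "one.gap u' v' = 0" "two.gap u' v' = 0"
    have pos: "u' > 0" "v' > 0"
      using near by auto
    then have v': "v' = depth u'"
      using zero one_gap_iff by simp
    then show "u' = u"
      using isolated [of u'] pos near zero by (simp add: mismatch_def)
    then show "v' = depth u"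
      using v' by simp
  qed (use u_pos depth_pos d in auto)
  then show ?thesis
    by blast
qed

end

lemma isolated_common_zero_commute:
  "isolated_common_zero F G u v \<longleftrightarrow> isolated_common_zero G F u v"
  unfolding isolated_common_zero_def by (simp only: conj_ac)

text \<open>
  The form in which time reversal acts on gaps, by \<open>gap_reverse\<close>.
\<close>

lemma isolated_common_zero_swap:
  assumes "\<And>u v. F' u v = - F v u" "\<And>u v. G' u v = - G v u" and "isolated_common_zero F' G' u v"
  shows "isolated_common_zero F G v u"
proof -
  obtain \<epsilon> where "\<epsilon> > 0"
    "\<And>u' v'. \<lbrakk>\<bar>u' - u\<bar> < \<epsilon>; \<bar>v' - v\<bar> < \<epsilon>; F v' u' = 0; G v' u' = 0\<rbrakk> \<Longrightarrow> u' = u \<and> v' = v"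
    using assms(3) unfolding isolated_common_zero_def assms(1,2) by auto
  then have "\<exists>\<epsilon>>0. \<forall>v' u'. \<bar>v' - v\<bar> < \<epsilon> \<and> \<bar>u' - u\<bar> < \<epsilon> \<and> F v' u' = 0 \<and> G v' u' = 0 \<longrightarrow> v' = v \<and> u' = u"
    by (intro exI [of _ \<epsilon>]) auto
  then show ?thesis
    using assms(3) unfolding isolated_common_zero_def assms(1,2) by simp
qed

text \<open>
  Interchanging the two zones changes the sign of both factors, so the first may be taken positive; a
  negative \<open>a1\<close> would then force a negative factor, since \<open>a2\<close> would be positive.
\<close>

lemma common_zero_of_positive_traces:
  assumes "focus_zone T1 D1 a1" "focus_zone T2 D2 a2" "a1 > 0 \<or> a2 > 0" "T1 > 0" "T2 > 0"
    and sign: "(a1 * T2 - a2 * T1) * (T1\<^sup>2 * D2 - T2\<^sup>2 * D1) > 0"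
  shows "\<exists>u v. isolated_common_zero (focus_zone.gap T1 D1 a1) (focus_zone.gap T2 D2 a2) u v"
proof -
  have *: "\<exists>u v. isolated_common_zero (focus_zone.gap T1 D1 a1) (focus_zone.gap T2 D2 a2) u v"
    if "focus_zone T1 D1 a1" "focus_zone T2 D2 a2" "a1 > 0 \<or> a2 > 0" "T1 > 0" "T2 > 0"
      "a1 * T2 - a2 * T1 > 0" "T1\<^sup>2 * D2 - T2\<^sup>2 * D1 > 0" for T1 D1 a1 T2 D2 a2
  proof -
    have "a1 > 0"
    proof (rule ccontr)
      assume "\<not> a1 > 0"
      then have "a1 * T2 \<le> 0" "a2 * T1 > 0"
        using that by (auto simp: mult_nonpos_nonneg)
      then show False
        using that(6) by simp
    qed
    then have "zone_pair T1 D1 a1 T2 D2 a2"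
      using that by (simp add: zone_pair_def zone_pair_axioms_def)
    then show ?thesis
      by (rule zone_pair.exists_isolated_common_zero)
  qed
  show ?thesis
  proof (cases "a1 * T2 - a2 * T1 > 0")
    case True
    then show ?thesis
      using assms by (intro *) (auto simp: zero_less_mult_iff)
  next
    case False
    then have "\<exists>u v. isolated_common_zero (focus_zone.gap T2 D2 a2) (focus_zone.gap T1 D1 a1) u v"
      using assms by (intro *) (auto simp: zero_less_mult_iff)
    then show ?thesis
      by (simp add: isolated_common_zero_commute)
  qed
qed

text \<open>
  Reversing time in both zones reduces negative traces to positive ones.
\<close>

lemma common_zero_of_gaps:
  assumes zones: "focus_zone T1 D1 a1" "focus_zone T2 D2 a2" and "a1 > 0 \<or> a2 > 0" "T1 * T2 > 0"
    and sign: "(a1 * T2 - a2 * T1) * (T1 * (T1\<^sup>2 * D2 - T2\<^sup>2 * D1)) > 0"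
  shows "\<exists>u v. isolated_common_zero (focus_zone.gap T1 D1 a1) (focus_zone.gap T2 D2 a2) u v"
proof (cases "T1 > 0")
  case True
  have "T1 * ((a1 * T2 - a2 * T1) * (T1\<^sup>2 * D2 - T2\<^sup>2 * D1)) > 0"
    using sign by (subst (asm) mult.left_commute)
  then have "T2 > 0" "(a1 * T2 - a2 * T1) * (T1\<^sup>2 * D2 - T2\<^sup>2 * D1) > 0"
    using assms(4) True by (auto simp only: zero_less_mult_iff [of T1])
  then show ?thesis
    using assms True by (intro common_zero_of_positive_traces) auto
next
  case False
  then have neg: "T1 < 0" "T2 < 0"
    using assms(4) by (auto simp: zero_less_mult_iff)
  define p where "p = a1 * T2 - a2 * T1"
  define X where "X = T1\<^sup>2 * D2 - T2\<^sup>2 * D1"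
  have "T1 * (p * X) > 0"
    using sign unfolding p_def X_def by (subst (asm) mult.left_commute)
  then have "- p * X > 0"
    using neg by (auto simp add: zero_less_mult_iff [of T1])
  moreover have "a1 * (- T2) - a2 * (- T1) = - p" "(- T1)\<^sup>2 * D2 - (- T2)\<^sup>2 * D1 = X"
    by (simp_all add: p_def X_def)
  ultimately have "(a1 * (- T2) - a2 * (- T1)) * ((- T1)\<^sup>2 * D2 - (- T2)\<^sup>2 * D1) > 0"
    by (simp only:)
  then obtain u v where "isolated_common_zero (focus_zone.gap (- T1) D1 a1) (focus_zone.gap (- T2) D2 a2) u v"
    using common_zero_of_positive_traces [of "- T1" D1 a1 "- T2" D2 a2] zones focus_zone_reverse assms(3) neg
    by auto
  then have "isolated_common_zero (focus_zone.gap T1 D1 a1) (focus_zone.gap T2 D2 a2) v u"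
    by (rule isolated_common_zero_swap [rotated 2]) (rule gap_reverse [OF zones(1)] gap_reverse [OF zones(2)])+
  then show ?thesis
    by blast
qed

section \<open>The linear flow and its half-arcs\<close>

context focus_zone
begin

text \<open>
  An eigenvalue of the linear part. The one with negative imaginary part is chosen because orbits
  turn clockwise.
\<close>

definition rate :: complex where
  "rate = Complex (T / 2) (- freq)"

text \<open>
  The complex coordinate centred at the equilibrium in which the vector field is multiplication by
  \<open>rate\<close>.
\<close>

definition to_focal :: "real \<times> real \<Rightarrow> complex" where
  "to_focal p = Complex (fst p - a / D) ((T / 2 * (fst p - a / D) - (snd p - T * a / D)) / freq)"

definition of_focal :: "complex \<Rightarrow> real \<times> real" where
  "of_focal w = (Re w + a / D, T * a / D + T / 2 * Re w - freq * Im w)"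

definition flow :: "real \<Rightarrow> real \<times> real \<Rightarrow> real \<times> real" where
  "flow t p = of_focal (exp (of_real t * rate) * to_focal p)"

lemma of_focal_to_focal [simp]: "of_focal (to_focal p) = p"
  using freq_pos by (simp add: of_focal_def to_focal_def prod_eq_iff)

lemma to_focal_of_focal [simp]: "to_focal (of_focal w) = w"
  using freq_pos by (simp add: of_focal_def to_focal_def complex_eq_iff)

lemma flow_0 [simp]: "flow 0 p = p"
  by (simp add: flow_def)

lemma flow_add: "flow (s + t) p = flow s (flow t p)"
  by (simp add: flow_def distrib_right exp_add mult.assoc)

lemma of_focal_derivative:
  assumes "(w has_vector_derivative rate * w t) (at t within S)"
  shows "((\<lambda>t. of_focal (w t)) has_vector_derivative linear_field T D a (of_focal (w t))) (at t within S)"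
proof -
  have Re: "((\<lambda>t. Re (w t)) has_vector_derivative Re (rate * w t)) (at t within S)"
    and Im: "((\<lambda>t. Im (w t)) has_vector_derivative Im (rate * w t)) (at t within S)"
    by (fact bounded_linear.has_vector_derivative [OF bounded_linear_Re assms]
        bounded_linear.has_vector_derivative [OF bounded_linear_Im assms])+
  have "((\<lambda>t. of_focal (w t)) has_vector_derivative
      (Re (rate * w t), T / 2 * Re (rate * w t) - freq * Im (rate * w t))) (at t within S)"
    unfolding of_focal_def
    by (intro has_vector_derivative_Pair) (auto intro!: derivative_eq_intros Re Im)
  moreover have "(Re (rate * w t), T / 2 * Re (rate * w t) - freq * Im (rate * w t))
      = linear_field T D a (of_focal (w t))"
  proof -
    have "freq * freq = D - T * T / 4"
      using freq_sq by (simp add: power2_eq_square)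
    then have "freq * (freq * Re (w t)) = (D - T * T / 4) * Re (w t)"
      by (simp add: mult.assoc[symmetric])
    then show ?thesis
      using D_pos by (simp add: linear_field_def of_focal_def rate_def field_simps)
  qed
  ultimately show ?thesis
    by simp
qed

lemma flow_derivative:
  "((\<lambda>t. flow t p) has_vector_derivative linear_field T D a (flow t p)) (at t within S)"
  unfolding flow_def
proof (rule of_focal_derivative)
  have "((\<lambda>t. exp (t *\<^sub>R rate)) has_vector_derivative exp (t *\<^sub>R rate) * rate) (at t within S)"
    by (rule exp_scaleR_has_vector_derivative_right)
  from has_vector_derivative_mult_left [OF this, of "to_focal p"]
  show "((\<lambda>t. exp (of_real t * rate) * to_focal p) has_vector_derivative
      rate * (exp (of_real t * rate) * to_focal p)) (at t within S)"
    by (simp add: scaleR_conv_of_real mult_ac)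
qed

lemma flow_continuous: "continuous_on S (\<lambda>(t, p). flow t p)"
  unfolding flow_def of_focal_def to_focal_def Complex_eq split_def using freq_pos
  by (intro continuous_intros) auto

lemma flow_continuous_time: "continuous_on S (\<lambda>t. flow t p)"
  using flow_derivative by (meson continuous_on_vector_derivative)

text \<open>
  In focal coordinates the solution times the inverse exponential has derivative zero.
\<close>

lemma flow_unique:
  assumes "\<And>t. t \<in> {r..s} \<Longrightarrow> (\<gamma> has_vector_derivative linear_field T D a (\<gamma> t)) (at t within {r..s})"
    and "t \<in> {r..s}"
  shows "\<gamma> t = flow (t - r) (\<gamma> r)"
proof -
  define c where "c t = exp (t *\<^sub>R (- rate)) * to_focal (\<gamma> t)" for t
  have "(c has_vector_derivative 0) (at t within {r..s})" if t: "t \<in> {r..s}" for t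
  proof -
    have G: "(\<gamma> has_vector_derivative linear_field T D a (\<gamma> t)) (at t within {r..s})"
      using assms(1) t by blast
    have 1: "((\<lambda>t. fst (\<gamma> t)) has_vector_derivative T * fst (\<gamma> t) - snd (\<gamma> t)) (at t within {r..s})"
      using bounded_linear.has_vector_derivative [OF bounded_linear_fst G] by (simp add: linear_field_def)
    have 2: "((\<lambda>t. snd (\<gamma> t)) has_vector_derivative D * fst (\<gamma> t) - a) (at t within {r..s})"
      using bounded_linear.has_vector_derivative [OF bounded_linear_snd G] by (simp add: linear_field_def)
    let ?X = "\<lambda>t. fst (\<gamma> t) - a / D"
    let ?Z = "\<lambda>t. (T / 2 * (fst (\<gamma> t) - a / D) - (snd (\<gamma> t) - T * a / D)) / freq"
    let ?X' = "T * fst (\<gamma> t) - snd (\<gamma> t)"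
    let ?Z' = "(T / 2 * ?X' - (D * fst (\<gamma> t) - a)) / freq"
    have X: "(?X has_vector_derivative ?X') (at t within {r..s})"
      using 1 by (auto intro!: derivative_eq_intros)
    have Z: "(?Z has_vector_derivative ?Z') (at t within {r..s})"
      using 1 2 by (auto intro!: derivative_eq_intros)
    have "((\<lambda>t. of_real (?X t) + \<i> * of_real (?Z t)) has_vector_derivative
        of_real ?X' + \<i> * of_real ?Z') (at t within {r..s})"
      by (intro has_vector_derivative_add has_vector_derivative_mult_right has_vector_derivative_of_real
          X [folded has_real_derivative_iff_has_vector_derivative]
          Z [folded has_real_derivative_iff_has_vector_derivative])
    moreover have "of_real (?X t) + \<i> * of_real (?Z t) = to_focal (\<gamma> t)" for t
      by (simp add: to_focal_def Complex_eq)
    ultimately have w: "((\<lambda>t. to_focal (\<gamma> t)) has_vector_derivative of_real ?X' + \<i> * of_real ?Z') (at t within {r..s})"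
      by simp
    have "of_real ?X' + \<i> * of_real ?Z' = rate * to_focal (\<gamma> t)"
    proof -
      have "freq * freq = D - T * T / 4"
        using freq_sq by (simp add: power2_eq_square)
      then have f: "freq * (freq * x) = (D - T * T / 4) * x" for x
        by (simp add: mult.assoc[symmetric])
      show ?thesis
        using D_pos freq_pos
        by (simp add: to_focal_def rate_def complex_eq_iff field_simps f)
    qed
    with w have w': "((\<lambda>t. to_focal (\<gamma> t)) has_vector_derivative rate * to_focal (\<gamma> t)) (at t within {r..s})"
      by simp
    have "((\<lambda>t. exp (t *\<^sub>R (- rate))) has_vector_derivative exp (t *\<^sub>R (- rate)) * (- rate)) (at t within {r..s})"
      by (rule exp_scaleR_has_vector_derivative_right)
    from has_vector_derivative_mult [OF this w']
    show ?thesis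
      unfolding c_def by (simp add: algebra_simps)
  qed
  then obtain k where "\<And>t. t \<in> {r..s} \<Longrightarrow> c t = k"
    using has_vector_derivative_zero_constant [of "{r..s}" c] by auto
  then have "c t = c r"
    using assms(2) by auto
  then have "exp (t *\<^sub>R rate) * c t = exp (t *\<^sub>R rate) * c r"
    by simp
  moreover have "exp (t *\<^sub>R rate) * c t = to_focal (\<gamma> t)"
    unfolding c_def mult.assoc[symmetric] exp_add_commuting[OF mult.commute, symmetric]
    by (simp flip: exp_add)
  moreover have "exp (t *\<^sub>R rate) * c r = exp (of_real (t - r) * rate) * to_focal (\<gamma> r)"
    unfolding c_def mult.assoc[symmetric]
    by (simp add: scaleR_conv_of_real algebra_simps flip: exp_add)
  ultimately show ?thesis
    unfolding flow_def by (metis of_focal_to_focal)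
qed

definition angle :: "real \<Rightarrow> real" where
  "angle y = arctan (slope y)"

lemma angle_bounds: "- (pi / 2) < angle y" "angle y < pi / 2"
  using arctan_lbound[of "slope y"] arctan_ubound[of "slope y"] by (simp_all add: angle_def)

lemma cos_angle_pos: "cos (angle y) > 0"
  using angle_bounds by (rule cos_gt_zero_pi)

lemma level_angle: "level y = T / (2 * freq) * angle y - ln (cos (angle y))"
proof -
  have "1 + (slope y)\<^sup>2 > 0"
    by (simp add: add_pos_nonneg)
  then have "ln (cos (angle y)) = - (ln (1 + (slope y)\<^sup>2) / 2)"
    by (simp add: angle_def cos_arctan ln_div ln_sqrt)
  then show ?thesis
    by (simp add: level_def angle_def)
qed

lemma angle_surj:
  assumes "- (pi / 2) < \<theta>" "\<theta> < pi / 2"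
  obtains y where "angle y = \<theta>"
proof
  have "slope (a / D * (freq * tan \<theta> + T / 2)) = tan \<theta>"
    using D_pos offset_nonzero freq_pos by (simp add: slope_def)
  then show "angle (a / D * (freq * tan \<theta> + T / 2)) = \<theta>"
    using assms by (simp add: angle_def arctan_tan)
qed

lemma angle_less_iff: "angle x < angle y \<longleftrightarrow> (if a > 0 then x < y else y < x)"
  using D_pos offset_nonzero freq_pos
  by (auto simp: angle_def arctan_less_iff slope_def divide_less_cancel mult_less_cancel_left)

text \<open>
  The horizontal focal coordinate of a moving point, relative to its initial value, is written
  through \<open>level\<close>. The term that multiplies \<open>T / (2 * freq)\<close> is the number of radians by which the
  rotation exceeds the difference of the two principal angles.
\<close>

lemma radius_ratio:
  "exp (T / 2 * t) * cos (angle y') / cos (angle y)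
    = exp (level y - level y' + T / (2 * freq) * (freq * t - angle y + angle y'))"
proof -
  have "level y - level y' + T / (2 * freq) * (freq * t - angle y + angle y')
      = T / 2 * t + ln (cos (angle y')) - ln (cos (angle y))"
    unfolding level_angle using freq_pos by (simp add: field_simps)
  also have "exp \<dots> = exp (T / 2 * t) * cos (angle y') / cos (angle y)"
    using cos_angle_pos by (simp add: exp_diff exp_add)
  finally show ?thesis ..
qed

lemma flow_from_line:
  "flow t (0, y) = of_focal (of_real (- (a / D) * (exp (T / 2 * t) / cos (angle y))) * cis (angle y - freq * t))"
proof -
  have "to_focal (0, y) = of_real (- (a / D)) * Complex 1 (slope y)"
    using D_pos offset_nonzero freq_pos by (simp add: to_focal_def slope_def complex_eq_iff field_simps)
  also have "Complex 1 (slope y) = cis (angle y) / of_real (cos (angle y))"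
    using cos_angle_pos[of y] tan_arctan[of "slope y"]
    by (simp add: complex_eq_iff angle_def tan_def)
  finally have "to_focal (0, y) = of_real (- (a / D) / cos (angle y)) * cis (angle y)"
    by simp
  moreover have "exp (of_real t * rate) = of_real (exp (T / 2 * t)) * cis (- (freq * t))"
    by (simp add: rate_def exp_eq_polar mult.commute)
  ultimately have "exp (of_real t * rate) * to_focal (0, y) =
      of_real (exp (T / 2 * t) * (- (a / D) / cos (angle y))) * (cis (- (freq * t)) * cis (angle y))"
    by simp
  also have "cis (- (freq * t)) * cis (angle y) = cis (angle y - freq * t)"
    by (simp add: cis_mult)
  also have "exp (T / 2 * t) * (- (a / D) / cos (angle y)) = - (a / D) * (exp (T / 2 * t) / cos (angle y))"
    by simp
  finally show ?thesis
    unfolding flow_def by (rule arg_cong)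
qed

lemma fst_flow_from_line:
  "fst (flow t (0, y)) = a / D * (1 - exp (T / 2 * t) * cos (angle y - freq * t) / cos (angle y))"
  unfolding flow_from_line by (simp add: of_focal_def algebra_simps)

lemma flow_returns:
  assumes "exp (T / 2 * t) * cos (angle y') / cos (angle y) = 1" "cis (angle y - freq * t) = cis (angle y')"
  shows "flow t (0, y) = (0, y')"
proof -
  have "exp (T / 2 * t) / cos (angle y) = 1 / cos (angle y')"
    using assms(1) cos_angle_pos[of y] cos_angle_pos[of y'] by (simp add: field_simps)
  then have "flow t (0, y) = flow 0 (0, y')"
    unfolding flow_from_line assms(2) by simp
  then show ?thesis
    by simp
qed

text \<open>
  The arc turns clockwise from the angle of \<open>(0, u)\<close> to that of \<open>(0, - v)\<close>, and \<open>gap u v = 0\<close> says that the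
  radius fits at that moment. In between, an angle at which the ray meets the line belongs to a height \<open>y\<close>,
  and the moving point is on the left of the line if its radius compares correctly with that of
  \<open>(0, y)\<close>, that is, by the order of the levels. These are known as \<open>level\<close> decreases on the negative and
  increases on the positive half-line.
\<close>

lemma left_half_arc:
  assumes uv: "u > 0" "v > 0" and gap: "gap u v = 0"
  obtains \<tau> where "\<tau> > 0" "flow \<tau> (0, u) = (0, - v)" "\<And>t. \<lbrakk>0 < t; t < \<tau>\<rbrakk> \<Longrightarrow> fst (flow t (0, u)) < 0"
proof (cases "a > 0")
  case True
  define \<tau> where "\<tau> = (angle u - angle (- v)) / freq"
  have lev: "level (- v) = level u"
    using gap True by (simp add: gap_def)
  have "angle (- v) < angle u"
    using True uv by (simp add: angle_less_iff)
  then have "\<tau> > 0"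
    using freq_pos by (simp add: \<tau>_def)
  moreover have \<tau>: "freq * \<tau> = angle u - angle (- v)"
    using freq_pos by (simp add: \<tau>_def)
  then have "flow \<tau> (0, u) = (0, - v)"
    by (intro flow_returns; simp only: radius_ratio) (simp_all add: lev)
  moreover have "fst (flow t (0, u)) < 0" if t: "0 < t" "t < \<tau>" for t
  proof -
    have ft: "0 < freq * t" "freq * t < angle u - angle (- v)"
      using t freq_pos by (simp_all flip: \<tau>)
    then obtain y where y: "angle y = angle u - freq * t"
      using angle_surj[of "angle u - freq * t"] angle_bounds[of u] angle_bounds[of "- v"] by auto
    have "angle (- v) < angle y" "angle y < angle u"
      using ft y by auto
    then have "- v < y" "y < u"
      using True by (simp_all add: angle_less_iff)
    then have "level y < level u"
      using level_strict_increasing[of y u] level_strict_decreasing[of "-v" y] lev by linarith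
    then have "exp (T / 2 * t) * cos (angle u - freq * t) / cos (angle u) > 1"
      unfolding y[symmetric] radius_ratio by (simp add: y)
    then show ?thesis
      unfolding fst_flow_from_line using True D_pos by (intro mult_pos_neg) auto
  qed
  ultimately show ?thesis
    by (rule that)
next
  case False
  then have neg: "a < 0"
    using offset_nonzero by simp
  \<comment> \<open>The equilibrium is in the zone, and the arc passes around it.\<close>
  define \<tau> where "\<tau> = (angle u - angle (- v) + 2 * pi) / freq"
  have lev: "level (- v) = level u + T / (2 * freq) * (2 * pi)"
    using gap False by (simp add: gap_def algebra_simps)
  have "\<tau> > 0"
    using freq_pos angle_bounds[of u] angle_bounds[of "- v"] by (simp add: \<tau>_def)
  moreover have \<tau>: "freq * \<tau> = angle u - angle (- v) + 2 * pi"
    using freq_pos by (simp add: \<tau>_def)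
  then have "flow \<tau> (0, u) = (0, - v)"
    by (intro flow_returns; simp only: radius_ratio) (simp_all add: lev complex_eq_iff cos_diff sin_diff)
  moreover have "fst (flow t (0, u)) < 0" if t: "0 < t" "t < \<tau>" for t
  proof -
    define \<theta> where "\<theta> = angle u - freq * t"
    have \<theta>: "angle (- v) - 2 * pi < \<theta>" "\<theta> < angle u"
    proof -
      have "freq * t < freq * \<tau>" "0 < freq * t"
        using t freq_pos by simp_all
      then show "angle (- v) - 2 * pi < \<theta>" "\<theta> < angle u"
        using \<tau> by (auto simp: \<theta>_def)
    qed
    have "exp (T / 2 * t) * cos \<theta> / cos (angle u) < 1"
    proof -
      \<comment> \<open>Before, while and after the ray from the equilibrium points away from the line.\<close>
      consider "- (pi / 2) < \<theta>" | "- (3 * pi / 2) \<le> \<theta>" "\<theta> \<le> - (pi / 2)" | "\<theta> < - (3 * pi / 2)"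
        by linarith
      then show ?thesis
      proof cases
        case 1
        then obtain y where y: "angle y = \<theta>"
          using angle_surj[of \<theta>] \<theta> angle_bounds[of u] by auto
        then have "u < y"
          using \<theta> False angle_less_iff[of y u] by auto
        then have "level u < level y"
          using uv level_strict_increasing by simp
        then show ?thesis
          unfolding y[symmetric] radius_ratio by (simp add: y \<theta>_def)
      next
        case 2
        have "cos \<theta> = - cos (\<theta> + pi)"
          by simp
        moreover have "cos (\<theta> + pi) \<ge> 0"
          using 2 by (intro cos_ge_zero) auto
        ultimately have "cos \<theta> \<le> 0"
          by simp
        then have "exp (T / 2 * t) * cos \<theta> / cos (angle u) \<le> 0"
          using cos_angle_pos[of u] by (simp add: divide_nonpos_pos mult_nonneg_nonpos)
        then show ?thesis
          by simp
      next
        case 3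
        obtain y where y: "angle y = \<theta> + 2 * pi"
          using angle_surj[of "\<theta> + 2 * pi"] \<theta> angle_bounds[of "- v"] 3 by auto
        then have "y < - v"
          using \<theta> False angle_less_iff[of "- v" y] by auto
        then have "level (- v) < level y"
          using uv level_strict_decreasing by simp
        moreover have "cos \<theta> = cos (angle y)"
          by (simp add: y)
        moreover have "freq * t - angle u + angle y = 2 * pi"
          by (simp add: y \<theta>_def)
        ultimately show ?thesis
          by (simp only: radius_ratio lev) simp
      qed
    qed
    then show ?thesis
      unfolding fst_flow_from_line \<theta>_def using neg D_pos by (intro mult_neg_pos) (auto simp: divide_neg_pos)
  qed
  ultimately show ?thesis
    by (rule that)
qed

end

section \<open>Filippov curves follow the linear flows\<close>

text \<open>
  Entire Filippov solutions with the exceptional null set removed by redefining the velocity there.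
  Only the integral equation is kept, and this makes the symmetries of the system immediate.
\<close>

definition filippov_curve ::
  "real \<Rightarrow> real \<Rightarrow> real \<Rightarrow> real \<Rightarrow> real \<Rightarrow> real \<Rightarrow> (real \<Rightarrow> real \<times> real) \<Rightarrow> bool" where
  "filippov_curve TL DL aL TR DR aR \<gamma> \<longleftrightarrow>
     (\<exists>v. (\<forall>t. v t \<in> filippov_field (linear_field TL DL aL) (linear_field TR DR aR) (\<gamma> t)) \<and>
          (\<forall>s t. s \<le> t \<longrightarrow> (v has_integral \<gamma> t - \<gamma> s) {s..t}))"

lemma filippov_solution_imp_curve:
  assumes "filippov_solution (linear_field TL DL aL) (linear_field TR DR aR) UNIV \<gamma>"
  shows "filippov_curve TL DL aL TR DR aR \<gamma>"
proof -
  let ?F = "\<lambda>t. filippov_field (linear_field TL DL aL) (linear_field TR DR aR) (\<gamma> t)"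
  obtain v where v: "\<And>s t. s \<le> t \<Longrightarrow> v absolutely_integrable_on {s..t} \<and> integral {s..t} v = \<gamma> t - \<gamma> s"
    and N: "negligible {t. v t \<notin> ?F t}"
    using assms unfolding filippov_solution_def by auto
  define w where "w t = (if v t \<in> ?F t then v t else (SOME z. z \<in> ?F t))" for t
  have ne: "\<exists>z. z \<in> ?F t" for t
    unfolding filippov_field_def by (auto simp only: split: if_split intro: hull_inc insertI1)
  have "w t \<in> ?F t" for t
    unfolding w_def using someI_ex [OF ne] by auto
  moreover have "(w has_integral \<gamma> t - \<gamma> s) {s..t}" if "s \<le> t" for s t
  proof (rule has_integral_spike [OF N])
    show "(v has_integral \<gamma> t - \<gamma> s) {s..t}"
      using v [OF that] by (metis absolutely_integrable_on_def has_integral_integral)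
  qed (auto simp: w_def)
  ultimately show ?thesis
    unfolding filippov_curve_def by blast
qed

lemma filippov_field_linear_image:
  assumes "linear f" "\<And>p. f (XL p) = YL (g p)" "\<And>p. f (XR p) = YR (g p)"
    and "\<And>p. fst (g p) = fst p" "w \<in> filippov_field XL XR p"
  shows "f w \<in> filippov_field YL YR (g p)"
proof -
  have "f w \<in> convex hull {YL (g p), YR (g p)}" if "w \<in> convex hull {XL p, XR p}"
    using convex_hull_linear_image [OF assms(1), of "{XL p, XR p}"] that assms(2,3) by auto
  then show ?thesis
    using assms by (auto simp: filippov_field_def split: if_splits)
qed

lemma filippov_field_flip_sides:
  assumes "linear f" "\<And>p. f (XL p) = YR (g p)" "\<And>p. f (XR p) = YL (g p)"
    and "\<And>p. fst (g p) = - fst p" "w \<in> filippov_field XL XR p"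
  shows "f w \<in> filippov_field YL YR (g p)"
proof -
  have "f w \<in> convex hull {YL (g p), YR (g p)}" if "w \<in> convex hull {XL p, XR p}"
    using convex_hull_linear_image [OF assms(1), of "{XL p, XR p}"] that assms(2,3)
    by (auto simp: insert_commute)
  then show ?thesis
    using assms by (auto simp: filippov_field_def split: if_splits)
qed

text \<open>
  The half-turn of the plane interchanges the two zones.
\<close>

lemma filippov_curve_rotate:
  assumes "filippov_curve TL DL aL TR DR aR \<gamma>"
  shows "filippov_curve TR DR (- aR) TL DL (- aL) (\<lambda>t. - \<gamma> t)"
proof -
  obtain v where v: "\<And>t. v t \<in> filippov_field (linear_field TL DL aL) (linear_field TR DR aR) (\<gamma> t)"
    and int: "\<And>s t. s \<le> t \<Longrightarrow> (v has_integral \<gamma> t - \<gamma> s) {s..t}"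
    using assms unfolding filippov_curve_def by blast
  have "- v t \<in> filippov_field (linear_field TR DR (- aR)) (linear_field TL DL (- aL)) (- \<gamma> t)" for t
    by (rule filippov_field_flip_sides [OF _ _ _ _ v]) (auto simp: linear_field_def linear_uminus)
  moreover have "((\<lambda>t. - v t) has_integral - \<gamma> t - - \<gamma> s) {s..t}" if "s \<le> t" for s t
    using has_integral_neg [OF int [OF that]] by simp
  ultimately show ?thesis
    unfolding filippov_curve_def by (intro exI [of _ "\<lambda>t. - v t"]) simp
qed

text \<open>
  Reversing time and reflecting \<open>y\<close> preserves each zone and changes the sign of its trace.
\<close>

lemma filippov_curve_reverse:
  assumes "filippov_curve TL DL aL TR DR aR \<gamma>"
  shows "filippov_curve (- TL) DL aL (- TR) DR aR (\<lambda>t. (fst (\<gamma> (- t)), - snd (\<gamma> (- t))))"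
proof -
  obtain v where v: "\<And>t. v t \<in> filippov_field (linear_field TL DL aL) (linear_field TR DR aR) (\<gamma> t)"
    and int: "\<And>s t. s \<le> t \<Longrightarrow> (v has_integral \<gamma> t - \<gamma> s) {s..t}"
    using assms unfolding filippov_curve_def by blast
  define f :: "real \<times> real \<Rightarrow> real \<times> real" where "f w = (- fst w, snd w)" for w
  have f: "bounded_linear f"
    unfolding f_def [abs_def]
    by (intro bounded_linear_Pair bounded_linear_minus bounded_linear_fst bounded_linear_snd)
  define g :: "real \<times> real \<Rightarrow> real \<times> real" where "g p = (fst p, - snd p)" for p
  have "f (v (- t)) \<in> filippov_field (linear_field (- TL) DL aL) (linear_field (- TR) DR aR) (g (\<gamma> (- t)))" for t
    by (rule filippov_field_linear_image [OF bounded_linear.linear [OF f] _ _ _ v])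
      (auto simp: linear_field_def f_def g_def)
  moreover have "((\<lambda>t. f (v (- t))) has_integral g (\<gamma> (- t)) - g (\<gamma> (- s))) {s..t}" if "s \<le> t" for s t
  proof -
    have "((\<lambda>t. v (- t)) has_integral \<gamma> (- s) - \<gamma> (- t)) {s..t}"
      using int [of "- t" "- s"] that has_integral_reflect_real [of v _ "-s" "-t"] by simp
    from has_integral_linear [OF this f] show ?thesis
      by (simp add: o_def f_def g_def)
  qed
  ultimately have "filippov_curve (- TL) DL aL (- TR) DR aR (\<lambda>t. g (\<gamma> (- t)))"
    unfolding filippov_curve_def by (intro exI [of _ "\<lambda>t. f (v (- t))"]) simp
  then show ?thesis
    by (simp only: g_def)
qed

text \<open>
  The composition of both symmetries fixes the points of the line and interchanges its two sides.
\<close>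

lemma filippov_curve_mirror:
  assumes "filippov_curve TL DL aL TR DR aR \<gamma>"
  shows "filippov_curve (- TR) DR (- aR) (- TL) DL (- aL) (\<lambda>t. (- fst (\<gamma> (- t)), snd (\<gamma> (- t))))"
  using filippov_curve_rotate [OF filippov_curve_reverse [OF assms]] by simp

lemma indefinite_integral_derivative:
  fixes g h v :: "real \<Rightarrow> 'a::banach"
  assumes int: "\<And>t. t \<in> {r..s} \<Longrightarrow> (v has_integral g t - g r) {r..t}"
    and h: "continuous_on {r..s} h" and eq: "\<And>t. t \<in> {r<..<s} \<Longrightarrow> v t = h t"
    and t: "t \<in> {r..s}"
  shows "(g has_vector_derivative h t) (at t within {r..s})"
proof -
  have "integral {r..x} h = g x - g r" if x: "x \<in> {r..s}" for x
  proof (rule integral_unique)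
    show "(h has_integral g x - g r) {r..x}"
      by (rule has_integral_spike_finite [OF _ _ int [OF x], of "{r, s}"]) (use x eq in \<open>auto simp: less_le\<close>)
  qed
  then have *: "g x = g r + integral {r..x} h" if "x \<in> {r..s}" for x
    using that by simp
  have "((\<lambda>x. g r + integral {r..x} h) has_vector_derivative 0 + h t) (at t within {r..s})"
    by (intro has_vector_derivative_add has_vector_derivative_const integral_has_vector_derivative h t)
  then have "((\<lambda>x. g r + integral {r..x} h) has_vector_derivative h t) (at t within {r..s})"
    by (simp only: add_0)
  with t * show ?thesis
    by (rule has_vector_derivative_transform)
qed

lemma filippov_curve_continuous:
  assumes "filippov_curve TL DL aL TR DR aR \<gamma>"
  shows "continuous_on S \<gamma>"
proof -
  obtain v where int: "\<And>s t. s \<le> t \<Longrightarrow> (v has_integral \<gamma> t - \<gamma> s) {s..t}"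
    using assms unfolding filippov_curve_def by blast
  have "isCont \<gamma> t" for t
  proof -
    have "continuous_on {t - 1..t + 1} (\<lambda>x. \<gamma> (t - 1) + integral {t - 1..x} v)"
      using int [of "t - 1" "t + 1"]
      by (intro continuous_intros indefinite_integral_continuous_1) (auto simp: integrable_on_def)
    moreover have "\<gamma> (t - 1) + integral {t - 1..x} v = \<gamma> x" if "x \<in> {t - 1..t + 1}" for x
      using int [of "t - 1" x] that by (simp add: integral_unique)
    ultimately have "continuous_on {t - 1..t + 1} \<gamma>"
      by (rule continuous_on_eq)
    then show ?thesis
      by (rule continuous_on_interior) auto
  qed
  then show ?thesis
    by (simp add: continuous_at_imp_continuous_on)
qed

text \<open>
  The first component of the Filippov field. It is single-valued and continuous, since both
  linear fields have first component \<open>- y\<close> on the line; hence the first coordinate of a solution is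
  continuously differentiable even where the second one is not.
\<close>

definition horizontal_speed :: "real \<Rightarrow> real \<Rightarrow> real \<times> real \<Rightarrow> real" where
  "horizontal_speed TL TR p = (if fst p \<le> 0 then TL * fst p else TR * fst p) - snd p"

lemma horizontal_speed_continuous: "continuous_on S (horizontal_speed TL TR)"
proof -
  have "horizontal_speed TL TR = (\<lambda>p. TL * min (fst p) 0 + TR * max (fst p) 0 - snd p)"
    by (auto simp: horizontal_speed_def fun_eq_iff min_def max_def)
  then show ?thesis
    by (simp only:) (intro continuous_intros)
qed

lemma fst_filippov_field:
  assumes "w \<in> filippov_field (linear_field TL DL aL) (linear_field TR DR aR) p"
  shows "fst w = horizontal_speed TL TR p"
proof (cases "fst p = 0")
  case True
  then obtain k l where kl: "k + l = 1"
    and w: "w = k *\<^sub>R linear_field TL DL aL p + l *\<^sub>R linear_field TR DR aR p"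
    using assms unfolding filippov_field_def convex_hull_2 by auto
  have "fst w = (k + l) * - snd p"
    unfolding w using True by (simp add: linear_field_def algebra_simps)
  also have "\<dots> = horizontal_speed TL TR p"
    using True by (simp add: kl horizontal_speed_def)
  finally show ?thesis .
next
  case False
  then show ?thesis
    using assms by (cases "fst p < 0") (simp_all add: filippov_field_def horizontal_speed_def linear_field_def)
qed

lemma filippov_curve_fst_derivative:
  assumes "filippov_curve TL DL aL TR DR aR \<gamma>"
  shows "((\<lambda>t. fst (\<gamma> t)) has_real_derivative horizontal_speed TL TR (\<gamma> t)) (at t)"
proof -
  obtain v where v: "\<And>t. v t \<in> filippov_field (linear_field TL DL aL) (linear_field TR DR aR) (\<gamma> t)"
    and int: "\<And>s t. s \<le> t \<Longrightarrow> (v has_integral \<gamma> t - \<gamma> s) {s..t}"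
    using assms unfolding filippov_curve_def by blast
  let ?I = "{t - 1..t + 1}"
  have "((\<lambda>t. fst (\<gamma> t)) has_vector_derivative horizontal_speed TL TR (\<gamma> t)) (at t within ?I)"
  proof (rule indefinite_integral_derivative)
    show "((\<lambda>t. fst (v t)) has_integral fst (\<gamma> x) - fst (\<gamma> (t - 1))) {t - 1..x}" if "x \<in> ?I" for x
      using has_integral_linear [OF int [of "t - 1" x] bounded_linear_fst] that by (simp add: o_def)
    show "continuous_on ?I (\<lambda>t. horizontal_speed TL TR (\<gamma> t))"
      by (rule continuous_on_compose2 [OF horizontal_speed_continuous filippov_curve_continuous [OF assms]])
        (rule subset_UNIV)
  qed (auto simp: fst_filippov_field [OF v])
  moreover have "at t within ?I = at t"
    by (rule at_within_Icc_at) simp_all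
  ultimately show ?thesis
    by (simp only: has_real_derivative_iff_has_vector_derivative)
qed

lemma (in focus_zone) filippov_curve_in_left_zone:
  assumes \<gamma>: "filippov_curve T D a TR DR aR \<gamma>"
    and left: "\<And>t. t \<in> {r<..<s} \<Longrightarrow> fst (\<gamma> t) < 0" and t: "t \<in> {r..s}"
  shows "\<gamma> t = flow (t - r) (\<gamma> r)"
proof (rule flow_unique [OF _ t])
  obtain v where v: "\<And>t. v t \<in> filippov_field (linear_field T D a) (linear_field TR DR aR) (\<gamma> t)"
    and int: "\<And>s t. s \<le> t \<Longrightarrow> (v has_integral \<gamma> t - \<gamma> s) {s..t}"
    using \<gamma> unfolding filippov_curve_def by blast
  fix t assume t: "t \<in> {r..s}"
  show "(\<gamma> has_vector_derivative linear_field T D a (\<gamma> t)) (at t within {r..s})"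
  proof (rule indefinite_integral_derivative [OF _ _ _ t])
    show "(v has_integral \<gamma> x - \<gamma> r) {r..x}" if "x \<in> {r..s}" for x
      using int that by simp
    show "continuous_on {r..s} (\<lambda>t. linear_field T D a (\<gamma> t))"
      unfolding linear_field_def by (intro continuous_intros filippov_curve_continuous [OF \<gamma>])
    show "v x = linear_field T D a (\<gamma> x)" if "x \<in> {r<..<s}" for x
      using v [of x] left [OF that] by (simp add: filippov_field_def)
  qed
qed

lemma first_time_nonneg:
  fixes f :: "real \<Rightarrow> real"
  assumes "continuous_on {r..s} f" "r \<le> s" "f s \<ge> 0"
  obtains t where "r \<le> t" "t \<le> s" "f t \<ge> 0" "\<And>x. \<lbrakk>r \<le> x; x < t\<rbrakk> \<Longrightarrow> f x < 0"
proof -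
  have "closed ({r..s} \<inter> f -` {0..})"
    using assms(1) by (intro continuous_closed_preimage) auto
  from compact_Int_closed [OF compact_Icc this, of r s]
  have "compact ({r..s} \<inter> f -` {0..})"
    by (simp add: Int_assoc[symmetric])
  moreover have "{r..s} \<inter> f -` {0..} \<noteq> {}"
    using assms by auto
  ultimately obtain t where t: "t \<in> {r..s} \<inter> f -` {0..}" "\<And>x. x \<in> {r..s} \<inter> f -` {0..} \<Longrightarrow> t \<le> x"
    by (meson compact_attains_inf)
  show ?thesis
  proof (rule that [of t])
    show "f x < 0" if "r \<le> x" "x < t" for x
      using t(2) [of x] t(1) that by force
  qed (use t(1) in auto)
qed

text \<open>
  The hypotheses require the solution to enter the left zone and the flow to remain there. If the solution left
  the zone before time \<open>h\<close>, it would agree with the flow up to its first exit, where the flow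
  is still strictly inside.
\<close>

lemma (in focus_zone) filippov_curve_follows_flow:
  assumes \<gamma>: "filippov_curve T D a TR DR aR \<gamma>"
    and start: "d > 0" "\<And>h. \<lbrakk>0 < h; h < d\<rbrakk> \<Longrightarrow> fst (\<gamma> (t + h)) < 0"
    and flow: "\<And>h. \<lbrakk>0 < h; h < \<tau>\<rbrakk> \<Longrightarrow> fst (flow h (\<gamma> t)) < 0"
    and h: "0 \<le> h" "h \<le> \<tau>"
  shows "\<gamma> (t + h) = flow h (\<gamma> t)"
proof (rule ccontr)
  assume ne: "\<gamma> (t + h) \<noteq> flow h (\<gamma> t)"
  have "\<exists>x\<in>{t<..<t+h}. fst (\<gamma> x) \<ge> 0"
  proof (rule ccontr)
    assume "\<not> ?thesis"
    then have "\<And>x. x \<in> {t<..<t + h} \<Longrightarrow> fst (\<gamma> x) < 0"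
      by (meson not_le)
    then have "\<gamma> (t + h) = flow (t + h - t) (\<gamma> t)"
      using h by (intro filippov_curve_in_left_zone [OF \<gamma>]) auto
    then show False
      using ne by simp
  qed
  then obtain s where s: "0 < s" "s < h" "fst (\<gamma> (t + s)) \<ge> 0"
    by (auto simp: algebra_simps) (metis add.commute add_less_cancel_left diff_add_cancel diff_gt_0_iff_gt)
  define d' where "d' = min d s / 2"
  have d': "0 < d'" "d' < d" "d' \<le> s"
    using start(1) s by (auto simp: d'_def)
  have "continuous_on {d'..s} (\<lambda>x. fst (\<gamma> (t + x)))"
    by (intro continuous_intros continuous_on_compose2 [OF filippov_curve_continuous [OF \<gamma>, of UNIV]]) auto
  then obtain r where r: "d' \<le> r" "r \<le> s" "fst (\<gamma> (t + r)) \<ge> 0"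
    and before: "\<And>x. \<lbrakk>d' \<le> x; x < r\<rbrakk> \<Longrightarrow> fst (\<gamma> (t + x)) < 0"
    using first_time_nonneg [of d' s "\<lambda>x. fst (\<gamma> (t + x))"] d' s by blast
  have "fst (\<gamma> x) < 0" if "x \<in> {t<..<t + r}" for x
    using start(2) [of "x - t"] before [of "x - t"] that d' by force
  then have "\<gamma> (t + r) = flow r (\<gamma> t)"
    using filippov_curve_in_left_zone [OF \<gamma>, of t "t + r" "t + r"] r d' by simp
  then show False
    using flow [of r] r s d' h by simp
qed

lemma (in focus_zone) filippov_curve_follows_left_arc:
  assumes \<gamma>: "filippov_curve T D a TR DR aR \<gamma>" and "\<gamma> t = (0, u)" "u > 0"
    and "\<And>h. \<lbrakk>0 < h; h < \<tau>\<rbrakk> \<Longrightarrow> fst (flow h (0, u)) < 0" and "0 \<le> h" "h \<le> \<tau>"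
  shows "\<gamma> (t + h) = flow h (0, u)"
proof -
  have "((\<lambda>t. fst (\<gamma> t)) has_real_derivative - u) (at t)"
    using filippov_curve_fst_derivative [OF \<gamma>, of t] assms(2) by (simp add: horizontal_speed_def)
  from DERIV_neg_dec_right [OF this] obtain d
    where "d > 0" "\<And>h. \<lbrakk>0 < h; h < d\<rbrakk> \<Longrightarrow> fst (\<gamma> (t + h)) < 0"
    using assms(2,3) by auto
  then show ?thesis
    using filippov_curve_follows_flow [OF \<gamma>, of d t \<tau> h] assms(2-) by simp
qed

text \<open>
  Continuous dependence on the initial point, uniform over all solutions: on a compact piece of
  an orbit inside the zone, nearby points stay inside the zone, so there any solution is given by
  the linear flow.
\<close>

lemma (in focus_zone) filippov_curve_near_left_point:
  assumes p: "\<And>h. \<lbrakk>0 \<le> h; h \<le> \<tau>\<rbrakk> \<Longrightarrow> fst (flow h p) < 0" and "0 \<le> \<tau>" "\<epsilon> > 0"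
  obtains \<delta> where "\<delta> > 0"
    "\<And>TR DR aR \<gamma> t. \<lbrakk>filippov_curve T D a TR DR aR \<gamma>; dist (\<gamma> t) p < \<delta>\<rbrakk> \<Longrightarrow>
       dist (\<gamma> (t + \<tau>)) (flow \<tau> p) < \<epsilon>"
proof -
  have "continuous_on {0..\<tau>} (\<lambda>h. fst (flow h p))"
    by (intro continuous_intros flow_continuous_time)
  then obtain m where "m \<in> {0..\<tau>}" "\<And>h. h \<in> {0..\<tau>} \<Longrightarrow> fst (flow h p) \<le> fst (flow m p)"
    using continuous_attains_sup [of "{0..\<tau>}" "\<lambda>h. fst (flow h p)"] \<open>0 \<le> \<tau>\<close> by auto
  then obtain \<mu> where \<mu>: "\<mu> > 0" "\<And>h. h \<in> {0..\<tau>} \<Longrightarrow> fst (flow h p) \<le> - \<mu>"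
    using p [of m] by (metis atLeastAtMost_iff minus_minus neg_0_less_iff_less)
  have "uniformly_continuous_on ({0..\<tau>} \<times> cball p 1) (\<lambda>(h, q). flow h q)"
    by (intro compact_uniformly_continuous flow_continuous compact_Times) auto
  then obtain \<delta> where \<delta>: "\<delta> > 0"
    and close: "\<And>h q h' q'. \<lbrakk>(h, q) \<in> {0..\<tau>} \<times> cball p 1; (h', q') \<in> {0..\<tau>} \<times> cball p 1;
      dist (h', q') (h, q) < \<delta>\<rbrakk> \<Longrightarrow> dist (flow h' q') (flow h q) < min \<mu> \<epsilon>"
    using \<mu>(1) \<open>\<epsilon> > 0\<close> unfolding uniformly_continuous_on_def
    by (metis (no_types, lifting) min_less_iff_conj case_prod_conv)
  show ?thesis
  proof (rule that [of "min \<delta> 1"])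
    fix TR DR aR \<gamma> t
    assume \<gamma>: "filippov_curve T D a TR DR aR \<gamma>" and near: "dist (\<gamma> t) p < min \<delta> 1"
    have fl: "dist (flow h (\<gamma> t)) (flow h p) < min \<mu> \<epsilon>" if "h \<in> {0..\<tau>}" for h
      using close [of h p h "\<gamma> t"] near that by (auto simp: dist_Pair_Pair dist_commute)
    have neg: "fst (flow h (\<gamma> t)) < 0" if "h \<in> {0..\<tau>}" for h
    proof -
      have "\<bar>fst (flow h (\<gamma> t)) - fst (flow h p)\<bar> \<le> dist (flow h (\<gamma> t)) (flow h p)"
        by (metis dist_fst_le dist_real_def)
      then show ?thesis
        using fl [OF that] \<mu>(2) [OF that] by linarith
    qed
    have "fst (\<gamma> t) < 0"
      using neg [of 0] \<open>0 \<le> \<tau>\<close> by simp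
    moreover have "isCont (\<lambda>x. fst (\<gamma> x)) t"
      using filippov_curve_fst_derivative [OF \<gamma>] by (rule DERIV_isCont)
    ultimately have "\<forall>\<^sub>F x in at t. fst (\<gamma> x) < 0"
      by (simp add: isCont_def order_tendsto_iff)
    then obtain d where d: "d > 0" "\<And>x. x \<noteq> t \<Longrightarrow> dist x t < d \<Longrightarrow> fst (\<gamma> x) < 0"
      unfolding eventually_at by auto
    have "\<gamma> (t + \<tau>) = flow \<tau> (\<gamma> t)"
      using filippov_curve_follows_flow [OF \<gamma> d(1), of t \<tau> \<tau>] d(2) neg \<open>0 \<le> \<tau>\<close>
      by (simp add: dist_real_def)
    then show "dist (\<gamma> (t + \<tau>)) (flow \<tau> p) < \<epsilon>"
      using fl [of \<tau>] \<open>0 \<le> \<tau>\<close> by simp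
  qed (use \<delta> in auto)
qed

section \<open>Stability of the crossings\<close>

lemma filippov_curve_speed_bound:
  assumes "w \<in> filippov_field (linear_field TL DL aL) (linear_field TR DR aR) p"
  shows "norm w \<le> (\<bar>TL\<bar> + \<bar>TR\<bar> + \<bar>DL\<bar> + \<bar>DR\<bar> + 1) * norm p + (\<bar>aL\<bar> + \<bar>aR\<bar>)" (is "_ \<le> ?B")
proof -
  have field: "norm (linear_field T D a p) \<le> ?B"
    if "\<bar>T\<bar> \<le> \<bar>TL\<bar> + \<bar>TR\<bar>" "\<bar>D\<bar> \<le> \<bar>DL\<bar> + \<bar>DR\<bar>" "\<bar>a\<bar> \<le> \<bar>aL\<bar> + \<bar>aR\<bar>" for T D a
  proof -
    have fs: "\<bar>fst p\<bar> \<le> norm p" "\<bar>snd p\<bar> \<le> norm p"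
      by (metis norm_fst_le real_norm_def prod.collapse) (metis norm_snd_le real_norm_def prod.collapse)
    have "norm (linear_field T D a p) \<le> \<bar>T * fst p - snd p\<bar> + \<bar>D * fst p - a\<bar>"
      unfolding linear_field_def by (metis norm_Pair_le real_norm_def)
    also have "\<dots> \<le> \<bar>T\<bar> * \<bar>fst p\<bar> + \<bar>snd p\<bar> + \<bar>D\<bar> * \<bar>fst p\<bar> + \<bar>a\<bar>"
      unfolding abs_mult[symmetric] by linarith
    also have "\<dots> \<le> (\<bar>TL\<bar> + \<bar>TR\<bar>) * norm p + norm p + (\<bar>DL\<bar> + \<bar>DR\<bar>) * norm p + (\<bar>aL\<bar> + \<bar>aR\<bar>)"
      using fs that by (intro add_mono mult_mono) auto
    finally show ?thesis
      by (simp add: algebra_simps)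
  qed
  have "{linear_field TL DL aL p, linear_field TR DR aR p} \<subseteq> cball 0 ?B"
    using field [of TL DL aL] field [of TR DR aR] by simp
  then have "convex hull {linear_field TL DL aL p, linear_field TR DR aR p} \<subseteq> cball 0 ?B"
    by (rule hull_minimal) (rule convex_cball)
  moreover have "w \<in> convex hull {linear_field TL DL aL p, linear_field TR DR aR p}"
    using assms hull_inc [of _ "{linear_field TL DL aL p, linear_field TR DR aR p}"]
    by (cases "fst p" "0::real" rule: linorder_cases) (simp_all add: filippov_field_def)
  ultimately have "w \<in> cball 0 ?B"
    by (rule subsetD)
  then show ?thesis
    by simp
qed

text \<open>
  Until the first exit from the ball the speed is at most \<open>M\<close>, and this is too slow to reach the boundary.
\<close>

lemma filippov_curve_stays_close:
  assumes \<gamma>: "filippov_curve TL DL aL TR DR aR \<gamma>" and "\<eta> > 0"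
    and M: "M > 0" "(\<bar>TL\<bar> + \<bar>TR\<bar> + \<bar>DL\<bar> + \<bar>DR\<bar> + 1) * (norm p + \<eta>) + (\<bar>aL\<bar> + \<bar>aR\<bar>) \<le> M"
    and start: "dist (\<gamma> t) p < \<eta> / 2" and h: "0 \<le> h" "M * h \<le> \<eta> / 2"
  shows "dist (\<gamma> (t + h)) p < \<eta>"
proof (rule ccontr)
  assume far: "\<not> dist (\<gamma> (t + h)) p < \<eta>"
  obtain v where v: "\<And>t. v t \<in> filippov_field (linear_field TL DL aL) (linear_field TR DR aR) (\<gamma> t)"
    and int: "\<And>s t. s \<le> t \<Longrightarrow> (v has_integral \<gamma> t - \<gamma> s) {s..t}"
    using \<gamma> unfolding filippov_curve_def by blast
  have "continuous_on {t..t + h} (\<lambda>x. dist (\<gamma> x) p - \<eta>)"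
    by (intro continuous_intros filippov_curve_continuous [OF \<gamma>])
  then obtain r where r: "t \<le> r" "r \<le> t + h" "dist (\<gamma> r) p - \<eta> \<ge> 0"
    and before: "\<And>x. \<lbrakk>t \<le> x; x < r\<rbrakk> \<Longrightarrow> dist (\<gamma> x) p - \<eta> < 0"
    using first_time_nonneg [of t "t + h" "\<lambda>x. dist (\<gamma> x) p - \<eta>"] far h by auto
  have "norm (\<gamma> r - \<gamma> t) \<le> M * measure lborel (cbox t r)"
  proof (rule has_integral_bound_spike_finite [of M "{r}" v])
    show "norm (v x) \<le> M" if "x \<in> cbox t r - {r}" for x
    proof -
      have "norm (\<gamma> x) \<le> norm p + \<eta>"
        using before [of x] that norm_triangle_sub [of "\<gamma> x" p] by (auto simp: dist_norm)
      then have "(\<bar>TL\<bar> + \<bar>TR\<bar> + \<bar>DL\<bar> + \<bar>DR\<bar> + 1) * norm (\<gamma> x)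
          \<le> (\<bar>TL\<bar> + \<bar>TR\<bar> + \<bar>DL\<bar> + \<bar>DR\<bar> + 1) * (norm p + \<eta>)"
        by (intro mult_left_mono) auto
      then show ?thesis
        using filippov_curve_speed_bound [OF v [of x]] M(2) by linarith
    qed
  qed (use int [OF r(1)] M in auto)
  also have "\<dots> \<le> M * h"
    using r M by simp
  finally have "dist (\<gamma> r) (\<gamma> t) \<le> \<eta> / 2"
    using h by (simp add: dist_norm)
  then show False
    using dist_triangle [of "\<gamma> r" p "\<gamma> t"] start r(3) by simp
qed

text \<open>
  Near a point of the positive half-line the horizontal speed is below a negative constant, so a
  solution that starts slightly to the right crosses the line before it can move far.
\<close>

lemma filippov_curve_crosses_from_right:
  assumes "y0 > 0" "\<epsilon> > 0"
  obtains \<delta> where "\<delta> > 0"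
    "\<And>\<gamma> t. \<lbrakk>filippov_curve TL DL aL TR DR aR \<gamma>; dist (\<gamma> t) (0, y0) < \<delta>; fst (\<gamma> t) \<ge> 0\<rbrakk> \<Longrightarrow>
       \<exists>s u. \<gamma> s = (0, u) \<and> \<bar>u - y0\<bar> < \<epsilon>"
proof -
  define K where "K = \<bar>TL\<bar> + \<bar>TR\<bar>"
  \<comment> \<open>Within this radius the horizontal speed is at most \<open>- y0 / 2\<close>.\<close>
  define \<eta> where "\<eta> = min \<epsilon> (y0 / (2 * (K + 1)))"
  have K: "K \<ge> 0"
    by (simp add: K_def)
  have \<eta>: "\<eta> > 0" "\<eta> \<le> \<epsilon>"
    using assms K by (auto simp: \<eta>_def)
  have "\<eta> \<le> y0 / (2 * (K + 1))"
    by (simp add: \<eta>_def)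
  then have \<eta>y: "(K + 1) * \<eta> \<le> y0 / 2"
    using K by (simp add: field_simps)
  define M where "M = (\<bar>TL\<bar> + \<bar>TR\<bar> + \<bar>DL\<bar> + \<bar>DR\<bar> + 1) * (norm (0::real, y0) + \<eta>) + (\<bar>aL\<bar> + \<bar>aR\<bar>)"
  have "M > 0"
    unfolding M_def using \<eta> by (intro add_pos_nonneg mult_pos_pos add_nonneg_pos) auto
  define h where "h = \<eta> / (2 * M)"
  have h: "h > 0" "M * h = \<eta> / 2"
    using \<open>M > 0\<close> \<eta> by (auto simp: h_def)
  show ?thesis
  proof (rule that [of "min (\<eta> / 2) (y0 / 2 * h)"])
    fix \<gamma> t
    assume \<gamma>: "filippov_curve TL DL aL TR DR aR \<gamma>" and right: "fst (\<gamma> t) \<ge> 0"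
      and near: "dist (\<gamma> t) (0, y0) < min (\<eta> / 2) (y0 / 2 * h)"
    have close: "dist (\<gamma> (t + x)) (0, y0) < \<eta>" if "0 \<le> x" "x \<le> h" for x
    proof (rule filippov_curve_stays_close [OF \<gamma> \<open>\<eta> > 0\<close> \<open>M > 0\<close>])
      have "M * x \<le> M * h"
        using that \<open>M > 0\<close> by simp
      then show "M * x \<le> \<eta> / 2"
        using h by simp
    qed (use near that M_def in auto)
    have "horizontal_speed TL TR (\<gamma> (t + x)) \<le> - (y0 / 2)" if "0 \<le> x" "x \<le> h" for x
    proof -
      let ?p = "\<gamma> (t + x)"
      have d: "\<bar>fst ?p\<bar> \<le> \<eta>" "\<bar>snd ?p - y0\<bar> \<le> \<eta>"
        using close [OF that] dist_fst_le [of ?p "(0, y0)"] dist_snd_le [of ?p "(0, y0)"]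
        by (auto simp: dist_real_def)
      have TL: "\<bar>TL\<bar> \<le> K" and TR: "\<bar>TR\<bar> \<le> K"
        by (simp_all add: K_def)
      have "\<bar>if fst ?p \<le> 0 then TL * fst ?p else TR * fst ?p\<bar> \<le> K * \<eta>"
        using mult_mono [OF TL d(1)] mult_mono [OF TR d(1)] K by (simp only: abs_mult split: if_split) simp
      then show ?thesis
        using d(2) \<eta>y unfolding horizontal_speed_def by (simp add: algebra_simps abs_le_iff)
    qed
    note speed = this
    have cont: "continuous_on {t..t + h} (\<lambda>x. fst (\<gamma> x))"
      by (intro continuous_intros filippov_curve_continuous [OF \<gamma>])
    have "\<exists>z. t < z \<and> z < t + h \<and> fst (\<gamma> (t + h)) - fst (\<gamma> t) = (t + h - t) * horizontal_speed TL TR (\<gamma> z)"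
      using h(1) by (intro MVT2 filippov_curve_fst_derivative [OF \<gamma>]) auto
    then obtain z where z: "t < z" "z < t + h"
      "fst (\<gamma> (t + h)) - fst (\<gamma> t) = h * horizontal_speed TL TR (\<gamma> z)"
      by auto
    have "h * horizontal_speed TL TR (\<gamma> z) \<le> h * - (y0 / 2)"
      using speed [of "z - t"] z h(1) by (intro mult_left_mono) auto
    moreover have "fst (\<gamma> t) < y0 / 2 * h"
      using near dist_fst_le [of "\<gamma> t" "(0, y0)"] by (auto simp: dist_real_def)
    ultimately have "fst (\<gamma> (t + h)) \<le> 0"
      using z(3) by (simp add: mult.commute)
    then obtain x where x: "t \<le> x" "x \<le> t + h" "fst (\<gamma> x) = 0"
      using IVT2' [of "\<lambda>x. fst (\<gamma> x)" "t + h" 0 t] right h(1) cont by auto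
    have "dist (\<gamma> x) (0, y0) < \<eta>"
      using close [of "x - t"] x by simp
    then have "\<bar>snd (\<gamma> x) - y0\<bar> < \<epsilon>"
      using \<eta> dist_snd_le [of "\<gamma> x" "(0, y0)"] by (auto simp: dist_real_def)
    then show "\<exists>s u. \<gamma> s = (0, u) \<and> \<bar>u - y0\<bar> < \<epsilon>"
      using x(3) by (metis prod.collapse)
  qed (use \<eta> h assms in auto)
qed

text \<open>
  A solution to the left of the line crossed it shortly before: the mirrored solution is to the right.
\<close>

lemma filippov_curve_crosses_upper:
  assumes "y0 > 0" "\<epsilon> > 0"
  obtains \<delta> where "\<delta> > 0"
    "\<And>\<gamma> t. \<lbrakk>filippov_curve TL DL aL TR DR aR \<gamma>; dist (\<gamma> t) (0, y0) < \<delta>\<rbrakk> \<Longrightarrow>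
       \<exists>s u. \<gamma> s = (0, u) \<and> \<bar>u - y0\<bar> < \<epsilon>"
proof -
  obtain \<delta>1 where \<delta>1: "\<delta>1 > 0"
    "\<And>\<gamma> t. \<lbrakk>filippov_curve TL DL aL TR DR aR \<gamma>; dist (\<gamma> t) (0, y0) < \<delta>1; fst (\<gamma> t) \<ge> 0\<rbrakk> \<Longrightarrow>
       \<exists>s u. \<gamma> s = (0, u) \<and> \<bar>u - y0\<bar> < \<epsilon>"
    by (rule filippov_curve_crosses_from_right [OF assms]) blast
  obtain \<delta>2 where \<delta>2: "\<delta>2 > 0"
    "\<And>\<gamma> t. \<lbrakk>filippov_curve (- TR) DR (- aR) (- TL) DL (- aL) \<gamma>; dist (\<gamma> t) (0, y0) < \<delta>2; fst (\<gamma> t) \<ge> 0\<rbrakk> \<Longrightarrow>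
       \<exists>s u. \<gamma> s = (0, u) \<and> \<bar>u - y0\<bar> < \<epsilon>"
    by (rule filippov_curve_crosses_from_right [OF assms]) blast
  show ?thesis
  proof (rule that [of "min \<delta>1 \<delta>2"])
    fix \<gamma> t
    assume \<gamma>: "filippov_curve TL DL aL TR DR aR \<gamma>" and near: "dist (\<gamma> t) (0, y0) < min \<delta>1 \<delta>2"
    show "\<exists>s u. \<gamma> s = (0, u) \<and> \<bar>u - y0\<bar> < \<epsilon>"
    proof (cases "fst (\<gamma> t) \<ge> 0")
      case True
      then show ?thesis
        using near by (intro \<delta>1(2) [OF \<gamma>]) auto
    next
      case False
      have "dist (- fst (\<gamma> (- (- t))), snd (\<gamma> (- (- t)))) (0, y0) = dist (\<gamma> t) (0, y0)"
        by (cases "\<gamma> t") (simp add: dist_Pair_Pair dist_real_def)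
      then obtain s u where "(- fst (\<gamma> (- s)), snd (\<gamma> (- s))) = (0, u)" "\<bar>u - y0\<bar> < \<epsilon>"
        using \<delta>2(2) [OF filippov_curve_mirror [OF \<gamma>], of "- t"] near False by auto
      then show ?thesis
        by (intro exI [of _ "- s"] exI [of _ u]) (simp add: prod_eq_iff)
    qed
  qed (use \<delta>1 \<delta>2 in auto)
qed

lemma filippov_curve_crosses_lower:
  assumes "y0 > 0" "\<epsilon> > 0"
  obtains \<delta> where "\<delta> > 0"
    "\<And>\<gamma> t. \<lbrakk>filippov_curve TL DL aL TR DR aR \<gamma>; dist (\<gamma> t) (0, - y0) < \<delta>\<rbrakk> \<Longrightarrow>
       \<exists>s u. \<gamma> s = (0, - u) \<and> \<bar>u - y0\<bar> < \<epsilon>"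
proof -
  obtain \<delta> where \<delta>: "\<delta> > 0"
    "\<And>\<gamma> t. \<lbrakk>filippov_curve TR DR (- aR) TL DL (- aL) \<gamma>; dist (\<gamma> t) (0, y0) < \<delta>\<rbrakk> \<Longrightarrow>
       \<exists>s u. \<gamma> s = (0, u) \<and> \<bar>u - y0\<bar> < \<epsilon>"
    by (rule filippov_curve_crosses_upper [OF assms]) blast
  show ?thesis
  proof (rule that [OF \<delta>(1)])
    fix \<gamma> t
    assume \<gamma>: "filippov_curve TL DL aL TR DR aR \<gamma>" and near: "dist (\<gamma> t) (0, - y0) < \<delta>"
    have "dist (- \<gamma> t) (0, y0) = dist (\<gamma> t) (0, - y0)"
      using dist_minus [of "\<gamma> t" "(0, - y0)"] by simp
    then obtain s u where "- \<gamma> s = (0, u)" "\<bar>u - y0\<bar> < \<epsilon>"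
      using \<delta>(2) [OF filippov_curve_rotate [OF \<gamma>], of t] near by auto
    then show "\<exists>s u. \<gamma> s = (0, - u) \<and> \<bar>u - y0\<bar> < \<epsilon>"
      by (intro exI [of _ s] exI [of _ u]) (auto simp: prod_eq_iff)
  qed
qed

text \<open>
  The solution follows the arc until it is close to the end point, where crossing is stable.
\<close>

lemma (in focus_zone) filippov_curve_near_left_arc:
  assumes v: "v > 0" "\<epsilon> > 0"
    and arc: "flow \<tau> (0, u) = (0, - v)" "\<And>h. \<lbrakk>0 < h; h < \<tau>\<rbrakk> \<Longrightarrow> fst (flow h (0, u)) < 0"
    and h: "0 < h" "h < \<tau>"
  obtains \<delta> where "\<delta> > 0"
    "\<And>\<gamma> t. \<lbrakk>filippov_curve T D a TR DR aR \<gamma>; dist (\<gamma> t) (flow h (0, u)) < \<delta>\<rbrakk> \<Longrightarrow>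
       \<exists>s v'. \<gamma> s = (0, - v') \<and> \<bar>v' - v\<bar> < \<epsilon>"
proof -
  obtain \<delta>1 where \<delta>1: "\<delta>1 > 0"
    "\<And>\<gamma> t. \<lbrakk>filippov_curve T D a TR DR aR \<gamma>; dist (\<gamma> t) (0, - v) < \<delta>1\<rbrakk> \<Longrightarrow>
       \<exists>s v'. \<gamma> s = (0, - v') \<and> \<bar>v' - v\<bar> < \<epsilon>"
    by (rule filippov_curve_crosses_lower [OF v]) blast
  have "isCont (\<lambda>s. flow s (0, u)) \<tau>"
    using flow_continuous_time [of UNIV "(0, u)"] by (simp add: continuous_on_eq_continuous_at)
  then obtain d where d: "d > 0" "\<And>s. dist s \<tau> < d \<Longrightarrow> dist (flow s (0, u)) (0, - v) < \<delta>1 / 2"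
    unfolding continuous_at_eps_delta using \<delta>1(1) arc(1) by (metis half_gt_zero)
  define k where "k = max h (\<tau> - d / 2)"
  have k: "h \<le> k" "k < \<tau>" "dist k \<tau> < d"
    using h d(1) by (auto simp: k_def dist_real_def)
  have flowk: "flow (k - h) (flow h (0, u)) = flow k (0, u)"
    by (simp flip: flow_add)
  obtain \<delta> where \<delta>: "\<delta> > 0"
    "\<And>TR DR aR \<gamma> t. \<lbrakk>filippov_curve T D a TR DR aR \<gamma>; dist (\<gamma> t) (flow h (0, u)) < \<delta>\<rbrakk> \<Longrightarrow>
       dist (\<gamma> (t + (k - h))) (flow (k - h) (flow h (0, u))) < \<delta>1 / 2"
  proof (rule filippov_curve_near_left_point [of "k - h" "flow h (0, u)" "\<delta>1 / 2"])
    show "fst (flow x (flow h (0, u))) < 0" if "0 \<le> x" "x \<le> k - h" for x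
      using arc(2) [of "x + h"] that h k by (simp flip: flow_add)
  qed (use k \<delta>1 in auto)
  show ?thesis
  proof (rule that [OF \<delta>(1)])
    fix \<gamma> t
    assume \<gamma>: "filippov_curve T D a TR DR aR \<gamma>" and near: "dist (\<gamma> t) (flow h (0, u)) < \<delta>"
    have "dist (\<gamma> (t + (k - h))) (0, - v) < \<delta>1"
      using \<delta>(2) [OF \<gamma> near] d(2) [OF k(3)] flowk
        dist_triangle [of "\<gamma> (t + (k - h))" "(0, - v)" "flow k (0, u)"] by simp
    then show "\<exists>s v'. \<gamma> s = (0, - v') \<and> \<bar>v' - v\<bar> < \<epsilon>"
      by (rule \<delta>1(2) [OF \<gamma>])
  qed
qed

lemma (in focus_zone) filippov_curve_reaches_lower:
  assumes \<gamma>: "filippov_curve T D a TR DR aR \<gamma>"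
    and uv: "u > 0" "v > 0" "gap u v = 0" and start: "(0, u) \<in> range \<gamma>"
  shows "(0, - v) \<in> range \<gamma>"
proof -
  obtain t where t: "\<gamma> t = (0, u)"
    using start by (metis rangeE)
  obtain \<tau> where "\<tau> > 0" "flow \<tau> (0, u) = (0, - v)"
    "\<And>t. \<lbrakk>0 < t; t < \<tau>\<rbrakk> \<Longrightarrow> fst (flow t (0, u)) < 0"
    by (rule left_half_arc [OF uv]) blast
  then have "\<gamma> (t + \<tau>) = (0, - v)"
    using filippov_curve_follows_left_arc [OF \<gamma> t uv(1), of \<tau> \<tau>] by simp
  then show ?thesis
    by (metis rangeI)
qed

text \<open>
  Forwards the solution follows the arc; backwards, the reversed solution follows the reversed arc.
\<close>

lemma left_arc_both_ends:
  assumes zone: "focus_zone TL DL aL" and \<gamma>: "filippov_curve TL DL aL TR DR aR \<gamma>"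
    and uv: "u > 0" "v > 0" "focus_zone.gap TL DL aL u v = 0"
  shows "(0, u) \<in> range \<gamma> \<longleftrightarrow> (0, - v) \<in> range \<gamma>"
proof
  assume "(0, u) \<in> range \<gamma>"
  then show "(0, - v) \<in> range \<gamma>"
    by (rule focus_zone.filippov_curve_reaches_lower [OF zone \<gamma> uv])
next
  assume "(0, - v) \<in> range \<gamma>"
  then obtain t where t: "\<gamma> t = (0, - v)"
    by (metis rangeE)
  let ?\<beta> = "\<lambda>t. (fst (\<gamma> (- t)), - snd (\<gamma> (- t)))"
  have "(0, v) = ?\<beta> (- t)"
    using t by simp
  then have "(0, v) \<in> range ?\<beta>"
    by (rule range_eqI)
  moreover have "focus_zone.gap (- TL) DL aL v u = 0"
    using uv(3) by (simp add: gap_reverse [OF zone])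
  ultimately have "(0, - u) \<in> range ?\<beta>"
    using focus_zone.filippov_curve_reaches_lower [OF focus_zone_reverse [OF zone] filippov_curve_reverse [OF \<gamma>] uv(2,1)]
    by blast
  then obtain s where "fst (\<gamma> (- s)) = 0" "snd (\<gamma> (- s)) = u"
    by auto
  then have "(0, u) = \<gamma> (- s)"
    by (simp add: prod_eq_iff)
  then show "(0, u) \<in> range \<gamma>"
    by (rule range_eqI)
qed

lemma right_arc_both_ends:
  assumes zone: "focus_zone TR DR aR" and \<gamma>: "filippov_curve TL DL aL TR DR aR \<gamma>"
    and uv: "u > 0" "v > 0" "focus_zone.gap TR DR (- aR) v u = 0"
  shows "(0, u) \<in> range \<gamma> \<longleftrightarrow> (0, - v) \<in> range \<gamma>"
proof -
  have "focus_zone TR DR (- aR)"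
    using zone by (simp add: focus_zone_def)
  from left_arc_both_ends [OF this filippov_curve_rotate [OF \<gamma>] uv(2,1,3)]
  have "(0, v) \<in> range (\<lambda>t. - \<gamma> t) \<longleftrightarrow> (0, - u) \<in> range (\<lambda>t. - \<gamma> t)" .
  moreover have "q \<in> range (\<lambda>t. - \<gamma> t) \<longleftrightarrow> - q \<in> range \<gamma>" for q
    by (auto simp: image_iff) (metis minus_minus)
  ultimately show ?thesis
    by simp
qed

section \<open>Squeezing between two zero curves\<close>

text \<open>
  On a square around \<open>(u, v)\<close> these conditions make the zero set of \<open>F\<close> the graph of an increasing function
  through the centre.
\<close>

definition increasing_zero_curve :: "(real \<Rightarrow> real \<Rightarrow> real) \<Rightarrow> real \<Rightarrow> real \<Rightarrow> real \<Rightarrow> bool" where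
  "increasing_zero_curve F u v r \<longleftrightarrow> r > 0 \<and> F u v = 0 \<and>
     (\<forall>x x' y. u - r \<le> x \<and> x < x' \<and> x' \<le> u + r \<and> v - r \<le> y \<and> y \<le> v + r \<longrightarrow> F x' y < F x y) \<and>
     (\<forall>x y y'. v - r \<le> y \<and> y < y' \<and> y' \<le> v + r \<and> u - r \<le> x \<and> x \<le> u + r \<longrightarrow> F x y < F x y') \<and>
     (\<forall>y S. continuous_on S (\<lambda>x. F x y)) \<and> (\<forall>x S. continuous_on S (\<lambda>y. F x y))"

lemma increasing_zero_curve_flip:
  assumes "increasing_zero_curve F u v r"
  shows "increasing_zero_curve (\<lambda>x y. - F (- x) (- y)) (- u) (- v) r"
proof -
  have flip: "continuous_on S (\<lambda>x. - f (- x))" if "continuous_on UNIV f" for f :: "real \<Rightarrow> real" and S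
    by (intro continuous_on_minus continuous_on_compose2 [OF that] continuous_on_id) auto
  have "\<And>y. continuous_on UNIV (\<lambda>x. F x y)" "\<And>x. continuous_on UNIV (\<lambda>y. F x y)"
    using assms unfolding increasing_zero_curve_def by blast+
  then have "continuous_on S (\<lambda>x. - F (- x) (- y))" "continuous_on S (\<lambda>y. - F (- x) (- y))" for S x y
    using flip [of "\<lambda>x. F x (- y)"] flip [of "F (- x)"] by blast+
  moreover have "- F (- x') (- y) < - F (- x) (- y)"
    if "- u - r \<le> x" "x < x'" "x' \<le> - u + r" "- v - r \<le> y" "y \<le> - v + r" for x x' y
  proof -
    have "u - r \<le> - x' \<and> - x' < - x \<and> - x \<le> u + r \<and> v - r \<le> - y \<and> - y \<le> v + r"
      using that by auto
    then have "F (- x) (- y) < F (- x') (- y)"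
      using assms unfolding increasing_zero_curve_def by blast
    then show ?thesis
      by simp
  qed
  moreover have "- F (- x) (- y) < - F (- x) (- y')"
    if "- v - r \<le> y" "y < y'" "y' \<le> - v + r" "- u - r \<le> x" "x \<le> - u + r" for x y y'
  proof -
    have "v - r \<le> - y' \<and> - y' < - y \<and> - y \<le> v + r \<and> u - r \<le> - x \<and> - x \<le> u + r"
      using that by auto
    then have "F (- x) (- y') < F (- x) (- y)"
      using assms unfolding increasing_zero_curve_def by blast
    then show ?thesis
      by simp
  qed
  ultimately show ?thesis
    using assms unfolding increasing_zero_curve_def by simp
qed

lemma increasing_zero_curve_above:
  assumes F: "increasing_zero_curve F u v r"
  obtains \<delta> where "\<delta> > 0" "\<delta> \<le> r"
    "\<And>x. \<lbrakk>u < x; x \<le> u + \<delta>\<rbrakk> \<Longrightarrow> \<exists>y. v < y \<and> y \<le> v + r \<and> F x y = 0"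
proof -
  have r: "r > 0" and zero: "F u v = 0"
    and dec: "\<And>x x' y. u - r \<le> x \<Longrightarrow> x < x' \<Longrightarrow> x' \<le> u + r \<Longrightarrow> v - r \<le> y \<Longrightarrow> y \<le> v + r \<Longrightarrow> F x' y < F x y"
    and inc: "\<And>x y y'. v - r \<le> y \<Longrightarrow> y < y' \<Longrightarrow> y' \<le> v + r \<Longrightarrow> u - r \<le> x \<Longrightarrow> x \<le> u + r \<Longrightarrow> F x y < F x y'"
    and c1: "\<And>y S. continuous_on S (\<lambda>x. F x y)" and c2: "\<And>x S. continuous_on S (\<lambda>y. F x y)"
    using F unfolding increasing_zero_curve_def by blast+
  have "F u (v + r) > 0"
    using inc [of v "v + r" u] r zero by simp
  moreover have "isCont (\<lambda>x. F x (v + r)) u"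
    using c1 [of UNIV "v + r"] by (simp add: continuous_on_eq_continuous_at)
  ultimately have "\<forall>\<^sub>F x in at u. F x (v + r) > 0"
    unfolding isCont_def by (intro order_tendstoD)
  then obtain d where d: "d > 0" "\<And>x. x \<noteq> u \<Longrightarrow> dist x u < d \<Longrightarrow> F x (v + r) > 0"
    unfolding eventually_at by auto
  show ?thesis
  proof (rule that [of "min r (d / 2)"])
    fix x assume x: "u < x" "x \<le> u + min r (d / 2)"
    then have "F x (v + r) > 0"
      using d by (auto simp: dist_real_def)
    moreover have "F x v < 0"
      using dec [of u x v] x r zero by simp
    ultimately obtain y where "v \<le> y" "y \<le> v + r" "F x y = 0"
      using IVT' [of "F x" v 0 "v + r"] r c2 by auto
    then show "\<exists>y. v < y \<and> y \<le> v + r \<and> F x y = 0"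
      using \<open>F x v < 0\<close> by (intro exI [of _ y]) (auto simp: less_le)
  qed (use r d in auto)
qed

lemma increasing_zero_curve_left:
  assumes F: "increasing_zero_curve F u v r"
    and xy: "u < x" "x \<le> u + r" "v < y" "y \<le> v + r" and neg: "F x y < 0"
  shows "\<exists>x'. u < x' \<and> x' < x \<and> F x' y = 0"
proof -
  have inc: "\<And>x y y'. v - r \<le> y \<Longrightarrow> y < y' \<Longrightarrow> y' \<le> v + r \<Longrightarrow> u - r \<le> x \<Longrightarrow> x \<le> u + r \<Longrightarrow> F x y < F x y'"
    and c: "continuous_on {u..x} (\<lambda>x. F x y)" and "F u v = 0" "r > 0"
    using F unfolding increasing_zero_curve_def by blast+
  then have pos: "F u y > 0"
    using inc [of v y u] xy by simp
  obtain x' where "u \<le> x'" "x' \<le> x" "F x' y = 0"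
    using IVT2' [of "\<lambda>x. F x y" x 0 u] pos neg xy c by auto
  then show ?thesis
    using pos neg by (intro exI [of _ x']) (auto simp: less_le)
qed

text \<open>
  Intended for \<open>S\<close> and \<open>R\<close> the sets of heights and depths at which an orbit meets the line: membership is
  transported along the zero curves.
\<close>

definition linked_by_zeros ::
  "(real \<Rightarrow> real \<Rightarrow> real) \<Rightarrow> (real \<Rightarrow> real \<Rightarrow> real) \<Rightarrow> real \<Rightarrow> real \<Rightarrow> real \<Rightarrow> real set \<Rightarrow> real set \<Rightarrow> bool" where
  "linked_by_zeros F G u v r S R \<longleftrightarrow>
     (\<forall>x y. \<bar>x - u\<bar> \<le> r \<and> \<bar>y - v\<bar> \<le> r \<and> (F x y = 0 \<or> G x y = 0) \<longrightarrow> (x \<in> S \<longleftrightarrow> y \<in> R))"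

text \<open>
  Let \<open>m\<close> be the least element of \<open>S\<close> in the interval. If \<open>m > u\<close>, the two zero curves have different
  ordinates over \<open>m\<close>. Going from \<open>m\<close> to the lower ordinate on one curve and back to the
  axis on the other curve leads to an element of \<open>S\<close> between \<open>u\<close> and \<open>m\<close>. No iteration is needed, and it does
  not matter which curve is the lower one.
\<close>

lemma squeeze_from_right:
  assumes F: "increasing_zero_curve F u v r" and G: "increasing_zero_curve G u v r"
    and isolated: "\<And>x y. \<lbrakk>\<bar>x - u\<bar> \<le> r; \<bar>y - v\<bar> \<le> r; F x y = 0; G x y = 0\<rbrakk> \<Longrightarrow> x = u"
  obtains \<delta> where "\<delta> > 0"
    "\<And>S R. \<lbrakk>closed S; linked_by_zeros F G u v r S R; \<exists>x\<in>S. u \<le> x \<and> x \<le> u + \<delta>\<rbrakk> \<Longrightarrow> u \<in> S"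
proof -
  obtain \<delta>1 where \<delta>1: "\<delta>1 > 0" "\<delta>1 \<le> r"
    "\<And>x. \<lbrakk>u < x; x \<le> u + \<delta>1\<rbrakk> \<Longrightarrow> \<exists>y. v < y \<and> y \<le> v + r \<and> F x y = 0"
    by (rule increasing_zero_curve_above [OF F]) blast
  obtain \<delta>2 where \<delta>2: "\<delta>2 > 0" "\<delta>2 \<le> r"
    "\<And>x. \<lbrakk>u < x; x \<le> u + \<delta>2\<rbrakk> \<Longrightarrow> \<exists>y. v < y \<and> y \<le> v + r \<and> G x y = 0"
    by (rule increasing_zero_curve_above [OF G]) blast
  show ?thesis
  proof (rule that [of "min \<delta>1 \<delta>2"])
    fix S R
    assume S: "closed S" and link: "linked_by_zeros F G u v r S R"
      and ne: "\<exists>x\<in>S. u \<le> x \<and> x \<le> u + min \<delta>1 \<delta>2"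
    have inv: "x \<in> S \<longleftrightarrow> y \<in> R" if "\<bar>x - u\<bar> \<le> r" "\<bar>y - v\<bar> \<le> r" "F x y = 0 \<or> G x y = 0" for x y
      using link that unfolding linked_by_zeros_def by blast
    have "compact ({u..u + min \<delta>1 \<delta>2} \<inter> S)"
      using S by (intro compact_Int_closed) auto
    moreover have "{u..u + min \<delta>1 \<delta>2} \<inter> S \<noteq> {}"
      using ne by auto
    ultimately obtain m where m: "m \<in> {u..u + min \<delta>1 \<delta>2} \<inter> S"
      and least: "\<And>x. x \<in> {u..u + min \<delta>1 \<delta>2} \<inter> S \<Longrightarrow> m \<le> x"
      by (meson compact_attains_inf)
    have mr: "u \<le> m" "m \<le> u + r" "\<bar>m - u\<bar> \<le> r" "m \<in> S" "m \<le> u + \<delta>1" "m \<le> u + \<delta>2" and r: "r > 0"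
      using m \<delta>1(1,2) by auto
    have no: False
      if H: "increasing_zero_curve H u v r" and HFG: "\<And>x y. K x y = 0 \<or> H x y = 0 \<Longrightarrow> F x y = 0 \<or> G x y = 0"
        and y: "u < m" "v < y" "y < y'" "y' \<le> v + r" "K m y = 0" "H m y' = 0" for H K y y'
    proof -
      have mono: "\<And>x y y'. v - r \<le> y \<Longrightarrow> y < y' \<Longrightarrow> y' \<le> v + r \<Longrightarrow> u - r \<le> x \<Longrightarrow> x \<le> u + r \<Longrightarrow> H x y < H x y'"
        using H unfolding increasing_zero_curve_def by blast
      have "H m y < H m y'"
        using y mr r by (intro mono) auto
      then have "H m y < 0"
        using y by simp
      then obtain x where x: "u < x" "x < m" "H x y = 0"
        using increasing_zero_curve_left [OF H, of m y] y mr by auto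
      have near: "\<bar>y - v\<bar> \<le> r" "\<bar>x - u\<bar> \<le> r"
        using x y mr by auto
      have "y \<in> R"
        using inv [of m y] HFG [of m y] y mr near by simp
      then have "x \<in> S"
        using inv [of x y] HFG [of x y] x near by simp
      moreover have "x \<le> u + min \<delta>1 \<delta>2"
        using x mr by linarith
      ultimately show False
        using least [of x] x by auto
    qed
    show "u \<in> S"
    proof (cases "m = u")
      case False
      then have um: "u < m"
        using m by auto
      obtain y where y: "v < y" "y \<le> v + r" "F m y = 0"
        using \<delta>1(3) [of m] mr um by auto
      obtain y' where y': "v < y'" "y' \<le> v + r" "G m y' = 0"
        using \<delta>2(3) [of m] mr um by auto
      have "y \<noteq> y'"
        using isolated [of m y] y y' mr um by auto
      then show ?thesis
        using no [OF G, of F y y'] no [OF F, of G y' y] y y' um by (cases y y' rule: linorder_cases) blast+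
    qed (use m in auto)
  qed (use \<delta>1 \<delta>2 in auto)
qed

lemma squeeze_to_common_zero:
  assumes F: "increasing_zero_curve F u v r" and G: "increasing_zero_curve G u v r"
    and isolated: "\<And>x y. \<lbrakk>\<bar>x - u\<bar> \<le> r; \<bar>y - v\<bar> \<le> r; F x y = 0; G x y = 0\<rbrakk> \<Longrightarrow> x = u"
  obtains \<delta> where "\<delta> > 0"
    "\<And>S R. \<lbrakk>closed S; linked_by_zeros F G u v r S R; \<exists>x\<in>S. \<bar>x - u\<bar> \<le> \<delta>\<rbrakk> \<Longrightarrow> u \<in> S"
proof -
  obtain \<delta>1 where \<delta>1: "\<delta>1 > 0"
    "\<And>S R. \<lbrakk>closed S; linked_by_zeros F G u v r S R; \<exists>x\<in>S. u \<le> x \<and> x \<le> u + \<delta>1\<rbrakk> \<Longrightarrow> u \<in> S"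
    by (rule squeeze_from_right [OF F G isolated]) (assumption | blast)+
  have flipped: "x = - u" if "\<bar>x - - u\<bar> \<le> r" "\<bar>y - - v\<bar> \<le> r" "- F (- x) (- y) = 0" "- G (- x) (- y) = 0" for x y
  proof -
    have "\<bar>- x - u\<bar> \<le> r" "\<bar>- y - v\<bar> \<le> r"
      using that by auto
    then have "- x = u"
      using that by (intro isolated [of _ "- y"]) auto
    then show ?thesis
      by simp
  qed
  obtain \<delta>2 where \<delta>2: "\<delta>2 > 0"
    "\<And>S R. \<lbrakk>closed S; linked_by_zeros (\<lambda>x y. - F (- x) (- y)) (\<lambda>x y. - G (- x) (- y)) (- u) (- v) r S R;
       \<exists>x\<in>S. - u \<le> x \<and> x \<le> - u + \<delta>2\<rbrakk> \<Longrightarrow> - u \<in> S"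
    by (rule squeeze_from_right [OF increasing_zero_curve_flip [OF F] increasing_zero_curve_flip [OF G] flipped])
      (assumption | blast)+
  show ?thesis
  proof (rule that [of "min \<delta>1 \<delta>2"])
    fix S R
    assume S: "closed S" and link: "linked_by_zeros F G u v r S R"
      and "\<exists>x\<in>S. \<bar>x - u\<bar> \<le> min \<delta>1 \<delta>2"
    then obtain x where x: "x \<in> S" "\<bar>x - u\<bar> \<le> min \<delta>1 \<delta>2"
      by blast
    show "u \<in> S"
    proof (cases "u \<le> x")
      case True
      then show ?thesis
        using x by (intro \<delta>1(2) [OF S link]) auto
    next
      case False
      have "- u \<in> uminus -` S"
      proof (rule \<delta>2(2) [of _ "uminus -` R"])
        show "closed (uminus -` S)"
          using S by (intro continuous_closed_vimage) (auto intro: continuous_intros)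
        have "- x \<in> S \<longleftrightarrow> - y \<in> R"
          if "\<bar>x - - u\<bar> \<le> r" "\<bar>y - - v\<bar> \<le> r" "F (- x) (- y) = 0 \<or> G (- x) (- y) = 0" for x y
        proof -
          have "\<bar>- x - u\<bar> \<le> r" "\<bar>- y - v\<bar> \<le> r"
            using that by auto
          then show ?thesis
            using link that(3) unfolding linked_by_zeros_def by blast
        qed
        then show "linked_by_zeros (\<lambda>x y. - F (- x) (- y)) (\<lambda>x y. - G (- x) (- y)) (- u) (- v) r
            (uminus -` S) (uminus -` R)"
          unfolding linked_by_zeros_def by simp
        show "\<exists>x\<in>uminus -` S. - u \<le> x \<and> x \<le> - u + \<delta>2"
          using x False by (intro bexI [of _ "- x"]) auto
      qed
      then show ?thesis
        by simp
    qed
  qed (use \<delta>1 \<delta>2 in auto)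
qed

lemma (in focus_zone) gap_increasing_zero_curve:
  assumes "gap u v = 0" "0 < r" "r \<le> u" "r \<le> v"
  shows "increasing_zero_curve gap u v r"
  using assms gap_less_first gap_less_second gap_continuous_first gap_continuous_second
  unfolding increasing_zero_curve_def by simp

text \<open>
  The zero curve of \<open>gap\<close>, read as a function of the second variable, is continuous.
\<close>

lemma (in focus_zone) gap_zero_near:
  assumes gap: "gap u v = 0" and "u > 0" "v > 0" "\<eta> > 0"
  obtains \<delta> where "\<delta> > 0" "\<And>y. \<bar>y - v\<bar> < \<delta> \<Longrightarrow> \<exists>x>0. \<bar>x - u\<bar> \<le> \<eta> \<and> gap x y = 0"
proof -
  define h where "h = min \<eta> (u / 2)"
  have h: "0 < h" "h < u" "h \<le> \<eta>"
    using assms by (auto simp: h_def)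
  have "gap (u + h) v < 0" "gap (u - h) v > 0"
    using gap_less_first [of u "u + h" v] gap_less_first [of "u - h" u v] gap h \<open>u > 0\<close> by auto
  moreover have "isCont (\<lambda>y. gap x y) v" for x
    using gap_continuous_second [of UNIV x] by (simp add: continuous_on_eq_continuous_at)
  ultimately have "\<forall>\<^sub>F y in at v. gap (u + h) y < 0" "\<forall>\<^sub>F y in at v. gap (u - h) y > 0"
    unfolding isCont_def by (blast intro: order_tendstoD)+
  then have "\<forall>\<^sub>F y in at v. gap (u + h) y < 0 \<and> gap (u - h) y > 0"
    by (rule eventually_conj)
  then obtain d where d: "d > 0" "\<And>y. y \<noteq> v \<Longrightarrow> dist y v < d \<Longrightarrow> gap (u + h) y < 0 \<and> gap (u - h) y > 0"
    unfolding eventually_at by auto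
  show ?thesis
  proof (rule that [OF d(1)])
    fix y assume y: "\<bar>y - v\<bar> < d"
    then have signs: "gap (u + h) y < 0" "gap (u - h) y > 0"
      using d(2) [of y] \<open>gap (u + h) v < 0\<close> \<open>gap (u - h) v > 0\<close> by (cases "y = v"; simp add: dist_real_def)+
    obtain x where "u - h \<le> x" "x \<le> u + h" "gap x y = 0"
      using IVT2' [of "\<lambda>x. gap x y" "u + h" 0 "u - h"] signs h gap_continuous_first by auto
    then show "\<exists>x>0. \<bar>x - u\<bar> \<le> \<eta> \<and> gap x y = 0"
      using h by (intro exI [of _ x]) auto
  qed
qed

lemma periodic_shift:
  fixes f :: "real \<Rightarrow> 'a"
  assumes "\<And>t. f (t + P) = f t"
  shows "f (t + of_int n * P) = f t"
proof (induction n rule: int_induct [of _ 0])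
  case (step1 i)
  then show ?case
    using assms [of "t + of_int i * P"] by (simp add: algebra_simps)
next
  case (step2 i)
  then show ?case
    using assms [of "t + of_int (i - 1) * P"] by (simp add: algebra_simps)
qed simp

lemma range_periodic:
  fixes f :: "real \<Rightarrow> 'a"
  assumes P: "P > 0" and per: "\<And>t. f (t + P) = f t"
  shows "range f = f ` {r..r + P}"
proof -
  have "f t \<in> f ` {r..r + P}" for t
  proof -
    let ?n = "\<lfloor>(t - r) / P\<rfloor>"
    have "of_int ?n * P \<le> t - r"
      using floor_correct [of "(t - r) / P"] pos_le_divide_eq [OF P] by blast
    moreover have "t - r < (of_int ?n + 1) * P"
    proof -
      have "(t - r) / P < of_int ?n + 1"
        by linarith
      then show ?thesis
        by (simp only: pos_divide_less_eq [OF P])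
    qed
    ultimately have "t + of_int (- ?n) * P \<in> {r..r + P}"
      by (auto simp: algebra_simps)
    then show ?thesis
      using periodic_shift [of f P, OF per, of t "- ?n"] by (metis imageI)
  qed
  then show ?thesis
    by auto
qed

section \<open>The limit cycle\<close>

text \<open>
  A left arc and a right arc that close up. The right arc is given by its image under the half-turn.
\<close>

locale two_arc_cycle =
  left: focus_zone TL DL aL + right: focus_zone TR DR "- aR" for TL DL aL TR DR aR :: real +
  fixes u v \<tau>L \<tau>R :: real
  assumes u_pos: "u > 0" and v_pos: "v > 0" and \<tau>L_pos: "\<tau>L > 0" and \<tau>R_pos: "\<tau>R > 0"
    and left_end: "left.flow \<tau>L (0, u) = (0, - v)"
    and left_arc: "\<And>t. \<lbrakk>0 < t; t < \<tau>L\<rbrakk> \<Longrightarrow> fst (left.flow t (0, u)) < 0"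
    and right_end: "right.flow \<tau>R (0, v) = (0, - u)"
    and right_arc: "\<And>t. \<lbrakk>0 < t; t < \<tau>R\<rbrakk> \<Longrightarrow> fst (right.flow t (0, v)) < 0"
begin

definition period :: real where
  "period = \<tau>L + \<tau>R"

text \<open>
  One revolution, from \<open>(0, u)\<close> through \<open>(0, - v)\<close> back to \<open>(0, u)\<close>.
\<close>

definition turn :: "real \<Rightarrow> real \<times> real" where
  "turn t = (if t \<le> \<tau>L then left.flow t (0, u) else - right.flow (t - \<tau>L) (0, v))"

definition orbit :: "real \<Rightarrow> real \<times> real" where
  "orbit t = turn (t - of_int \<lfloor>t / period\<rfloor> * period)"

definition cycle :: "(real \<times> real) set" where
  "cycle = turn ` {0..period}"

lemma period_pos: "period > 0"
  using \<tau>L_pos \<tau>R_pos by (simp add: period_def)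

lemma turn_values [simp]: "turn 0 = (0, u)" "turn \<tau>L = (0, - v)" "turn period = (0, u)"
  using \<tau>L_pos \<tau>R_pos left_end right_end by (simp_all add: turn_def period_def)

lemma turn_left: "turn t = left.flow t (0, u)" if "t \<le> \<tau>L"
  using that by (simp add: turn_def)

lemma turn_right: "turn t = - right.flow (t - \<tau>L) (0, v)" if "\<tau>L \<le> t"
  using that left_end by (cases "t = \<tau>L") (auto simp: turn_def)

lemma fst_turn_left: "fst (turn t) < 0" if "0 < t" "t < \<tau>L"
  using left_arc [OF that] that by (simp add: turn_left)

lemma fst_turn_right: "fst (turn t) > 0" if "\<tau>L < t" "t < period"
  using right_arc [of "t - \<tau>L"] that by (simp add: turn_right period_def)

lemma orbit_turn: "orbit t = turn t" if "0 \<le> t" "t \<le> period"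
proof (cases "t = period")
  case True
  then show ?thesis
    using period_pos by (simp add: orbit_def)
next
  case False
  then have "0 \<le> t / period" "t / period < 1"
    using that period_pos by auto
  then have "\<lfloor>t / period\<rfloor> = 0"
    by linarith
  then show ?thesis
    by (simp add: orbit_def)
qed

lemma orbit_periodic: "orbit (t + period) = orbit t"
proof -
  have "(t + period) / period = t / period + 1"
    using period_pos by (simp add: field_simps)
  then have "\<lfloor>(t + period) / period\<rfloor> = \<lfloor>t / period\<rfloor> + 1"
    by simp
  then show ?thesis
    by (simp add: orbit_def algebra_simps)
qed

lemma range_orbit: "range orbit = cycle"
proof -
  have "range orbit = orbit ` {0..0 + period}"
    using period_pos orbit_periodic by (rule range_periodic)
  also have "\<dots> = cycle"
    unfolding cycle_def by (intro image_cong) (auto simp: orbit_turn)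
  finally show ?thesis .
qed

abbreviation "XL \<equiv> linear_field TL DL aL"
abbreviation "XR \<equiv> linear_field TR DR aR"

text \<open>
  On the line the value is arbitrary in the field, as the line is met at isolated times.
\<close>

definition velocity :: "real \<Rightarrow> real \<times> real" where
  "velocity t = (if fst (orbit t) < 0 then XL (orbit t) else XR (orbit t))"

lemma velocity_in_field: "velocity t \<in> filippov_field XL XR (orbit t)"
  by (auto simp: velocity_def filippov_field_def intro: hull_inc)

text \<open>
  Quantifying over all subintervals makes the property compose at common end points and
  independent of any regularity of the orbit there.
\<close>

definition integrates_on :: "real \<Rightarrow> real \<Rightarrow> bool" where
  "integrates_on A B \<longleftrightarrow>
     (\<forall>s t. A \<le> s \<and> s \<le> t \<and> t \<le> B \<longrightarrow> (velocity has_integral orbit t - orbit s) {s..t})"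

lemma integrates_on_join: "integrates_on A C" if "integrates_on A B" "integrates_on B C"
  unfolding integrates_on_def
proof (intro allI impI; elim conjE)
  fix s t assume st: "A \<le> s" "s \<le> t" "t \<le> C"
  consider "t \<le> B" | "B \<le> s" | "s < B" "B < t"
    by linarith
  then show "(velocity has_integral orbit t - orbit s) {s..t}"
  proof cases
    case 3
    have "(velocity has_integral (orbit B - orbit s) + (orbit t - orbit B)) {s..t}"
      using 3 st that unfolding integrates_on_def
      by (intro has_integral_combine [of s B t]) auto
    then show ?thesis
      by simp
  qed (use st that in \<open>auto simp: integrates_on_def\<close>)
qed

lemma integrates_on_left: "integrates_on 0 \<tau>L"
  unfolding integrates_on_def
proof (intro allI impI; elim conjE)
  fix s t assume st: "0 \<le> s" "s \<le> t" "t \<le> \<tau>L"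
  have orbit: "orbit x = left.flow x (0, u)" if "0 \<le> x" "x \<le> \<tau>L" for x
    using that \<tau>R_pos by (simp add: orbit_turn turn_left period_def)
  have "((\<lambda>x. XL (left.flow x (0, u))) has_integral left.flow t (0, u) - left.flow s (0, u)) {s..t}"
    using st by (intro fundamental_theorem_of_calculus left.flow_derivative)
  then have "(velocity has_integral left.flow t (0, u) - left.flow s (0, u)) {s..t}"
    by (rule has_integral_spike_finite [of "{0, \<tau>L}", rotated 2])
      (use st left_arc in \<open>auto simp: velocity_def orbit\<close>)
  then show "(velocity has_integral orbit t - orbit s) {s..t}"
    using st by (simp add: orbit)
qed

lemma integrates_on_right: "integrates_on \<tau>L period"
  unfolding integrates_on_def
proof (intro allI impI; elim conjE)
  fix s t assume st: "\<tau>L \<le> s" "s \<le> t" "t \<le> period"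
  let ?f = "\<lambda>x. - right.flow (x - \<tau>L) (0, v)"
  have orbit: "orbit x = ?f x" if "\<tau>L \<le> x" "x \<le> period" for x
    using that \<tau>L_pos by (simp add: orbit_turn turn_right)
  have "(?f has_vector_derivative XR (?f x)) (at x within {s..t})" for x
  proof -
    have "((\<lambda>x. right.flow (x - \<tau>L) (0, v)) has_vector_derivative
        1 *\<^sub>R linear_field TR DR (- aR) (right.flow (x - \<tau>L) (0, v))) (at x within {s..t})"
      by (rule vector_diff_chain_within [of "\<lambda>x. x - \<tau>L", unfolded o_def])
        (auto intro!: derivative_eq_intros right.flow_derivative)
    from has_vector_derivative_minus [OF this] show ?thesis
      by (simp add: linear_field_def)
  qed
  then have "((\<lambda>x. XR (?f x)) has_integral ?f t - ?f s) {s..t}"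
    using st by (intro fundamental_theorem_of_calculus)
  then have "(velocity has_integral ?f t - ?f s) {s..t}"
  proof (rule has_integral_spike_finite [of "{\<tau>L, period}", rotated 2])
    show "velocity x = XR (?f x)" if "x \<in> {s..t} - {\<tau>L, period}" for x
    proof -
      have "fst (turn x) > 0"
        using that st by (intro fst_turn_right) auto
      then show ?thesis
        using that st \<tau>L_pos by (simp add: velocity_def orbit [symmetric] orbit_turn)
    qed
  qed simp
  then show "(velocity has_integral orbit t - orbit s) {s..t}"
    using st by (simp add: orbit)
qed

lemma integrates_on_shift: "integrates_on (A + period) (B + period)" if "integrates_on A B"
  unfolding integrates_on_def
proof (intro allI impI; elim conjE)
  fix s t assume st: "A + period \<le> s" "s \<le> t" "t \<le> B + period"
  have previous: "orbit (x - period) = orbit x" for x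
    using orbit_periodic [of "x - period"] by simp
  have "(velocity has_integral orbit (t - period) - orbit (s - period)) {s - period..t - period}"
    using that st unfolding integrates_on_def by simp
  from has_integral_affinity [OF this [unfolded cbox_interval [symmetric]], of 1 "- period"]
  have "((\<lambda>x. velocity (x - period)) has_integral orbit t - orbit s) {s..t}"
    by (simp add: previous)
  moreover have "velocity (x - period) = velocity x" for x
    by (simp only: velocity_def previous)
  ultimately show "(velocity has_integral orbit t - orbit s) {s..t}"
    by (simp only:)
qed

lemma integrates_on_long: "integrates_on (- (real n * period)) (real n * period)"
proof (induction n)
  case 0
  have "(velocity has_integral orbit t - orbit s) {s..t}" if "0 \<le> s" "s \<le> t" "t \<le> 0" for s t
  proof -
    have "s = t"
      using that by simp
    then show ?thesis
      by (simp add: has_integral_refl)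
  qed
  then show ?case
    by (simp add: integrates_on_def)
next
  case (Suc n)
  have one: "integrates_on 0 period"
    using integrates_on_left integrates_on_right by (rule integrates_on_join)
  have up: "integrates_on (real n * period) (real n * period + period)" for n
  proof (induction n)
    case (Suc n)
    then show ?case
      using integrates_on_shift [OF Suc] by (simp add: algebra_simps)
  qed (simp add: one)
  have down: "integrates_on (- (real n * period)) (- (real n * period) + period)" for n
  proof (induction n)
    case (Suc n)
    show ?case
      unfolding integrates_on_def
    proof (intro allI impI; elim conjE)
      fix s t assume st: "- (real (Suc n) * period) \<le> s" "s \<le> t" "t \<le> - (real (Suc n) * period) + period"
      have "(velocity has_integral orbit (t + period) - orbit (s + period)) {s + period..t + period}"
        using Suc st unfolding integrates_on_def by (simp add: algebra_simps)
      from has_integral_affinity [OF this [unfolded cbox_interval [symmetric]], of 1 period]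
      have "((\<lambda>x. velocity (x + period)) has_integral orbit t - orbit s) {s..t}"
        by (simp add: orbit_periodic)
      moreover have "velocity (x + period) = velocity x" for x
        by (simp only: velocity_def orbit_periodic)
      ultimately show "(velocity has_integral orbit t - orbit s) {s..t}"
        by (simp only:)
    qed
  qed (simp add: one)
  have "integrates_on (- (real (Suc n) * period)) (- (real n * period))"
    using down [of "Suc n"] by (simp add: algebra_simps)
  from integrates_on_join [OF integrates_on_join [OF this Suc] up]
  show ?case
    by (simp add: algebra_simps)
qed

lemma velocity_integral: "(velocity has_integral orbit t - orbit s) {s..t}" if "s \<le> t"
proof -
  obtain n where n: "max \<bar>s\<bar> \<bar>t\<bar> < real n * period"
    using reals_Archimedean3 [OF period_pos] by blast
  then have "- (real n * period) \<le> s" "t \<le> real n * period"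
    by linarith+
  then show ?thesis
    using that integrates_on_long [of n] unfolding integrates_on_def by blast
qed

lemma orbit_is_curve: "filippov_curve TL DL aL TR DR aR orbit"
  unfolding filippov_curve_def using velocity_in_field velocity_integral by blast

lemma compact_cycle: "compact cycle"
proof -
  have "cycle = orbit ` {0..period}"
    unfolding cycle_def by (intro image_cong) (auto simp: orbit_turn)
  then show ?thesis
    using compact_continuous_image [OF filippov_curve_continuous [OF orbit_is_curve] compact_Icc] by simp
qed

lemma orbit_solution: "filippov_solution XL XR UNIV orbit"
  unfolding filippov_solution_def
proof (intro exI [of _ velocity] conjI ballI impI)
  obtain b where b: "\<And>p. p \<in> cycle \<Longrightarrow> norm p \<le> b"
    using compact_imp_bounded [OF compact_cycle] by (auto simp: bounded_iff)
  let ?c = "\<bar>TL\<bar> + \<bar>TR\<bar> + \<bar>DL\<bar> + \<bar>DR\<bar> + 1"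
  have bound: "norm (velocity x) \<le> ?c * b + (\<bar>aL\<bar> + \<bar>aR\<bar>)" for x
  proof -
    have "norm (orbit x) \<le> b"
      using b range_orbit by blast
    then have "?c * norm (orbit x) \<le> ?c * b"
      by (intro mult_left_mono) auto
    then show ?thesis
      using filippov_curve_speed_bound [OF velocity_in_field [of x]] by linarith
  qed
  fix s t :: real assume st: "s \<le> t"
  show "velocity absolutely_integrable_on {s..t}"
  proof (rule absolutely_integrable_integrable_bound)
    show "velocity integrable_on {s..t}"
      using velocity_integral [OF st] by (rule has_integral_integrable)
    show "(\<lambda>x. ?c * b + (\<bar>aL\<bar> + \<bar>aR\<bar>)) integrable_on {s..t}"
      by (rule integrable_const_ivl)
  qed (rule bound)
  show "integral {s..t} velocity = orbit t - orbit s"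
    using velocity_integral [OF st] by (rule integral_unique)
next
  show "negligible {t \<in> UNIV. velocity t \<notin> filippov_field XL XR (orbit t)}"
    using velocity_in_field by simp
qed

lemma cycle_on_line: "p \<in> cycle \<Longrightarrow> fst p = 0 \<Longrightarrow> p = (0, u) \<or> p = (0, - v)"
proof -
  assume "p \<in> cycle" "fst p = 0"
  then obtain t where t: "0 \<le> t" "t \<le> period" "p = turn t" "fst (turn t) = 0"
    by (auto simp: cycle_def)
  then have "t = 0 \<or> t = \<tau>L \<or> t = period"
    using fst_turn_left [of t] fst_turn_right [of t] by force
  then show ?thesis
    using t(3) by auto
qed

lemma cycle_closed_crossing_orbit: "closed_crossing_orbit XL XR cycle"
proof -
  have "orbit 0 \<noteq> orbit \<tau>L"
    using period_pos \<tau>L_pos \<tau>R_pos u_pos v_pos by (simp add: orbit_turn period_def)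
  then have "closed_orbit XL XR cycle"
    unfolding closed_orbit_def
    using period_pos orbit_solution orbit_periodic range_orbit
    by (intro exI [of _ orbit] exI [of _ period]) auto
  moreover have "(0, u) \<in> cycle"
    using range_orbit period_pos by (metis orbit_turn order_refl less_imp_le rangeI turn_values(1))
  moreover have "crossing_point XL XR p" if "p \<in> cycle \<inter> switching_line" for p
    using cycle_on_line [of p] that u_pos v_pos
    by (auto simp: crossing_point_def switching_line_def linear_field_def zero_less_mult_iff)
  ultimately show ?thesis
    unfolding closed_crossing_orbit_def by (auto simp: switching_line_def)
qed

lemma curve_follows_turn:
  assumes \<gamma>: "filippov_curve TL DL aL TR DR aR \<gamma>" and start: "\<gamma> t = (0, u)"
    and h: "0 \<le> h" "h \<le> period"
  shows "\<gamma> (t + h) = turn h"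
proof -
  have left: "\<gamma> (t + h) = left.flow h (0, u)" if "0 \<le> h" "h \<le> \<tau>L" for h
    using left.filippov_curve_follows_left_arc [OF \<gamma> start u_pos left_arc, of \<tau>L h] that by simp
  show ?thesis
  proof (cases "h \<le> \<tau>L")
    case True
    then show ?thesis
      using left h by (simp add: turn_left)
  next
    case False
    have "- \<gamma> (t + \<tau>L) = (0, v)"
      using left [of \<tau>L] \<tau>L_pos left_end by simp
    from right.filippov_curve_follows_left_arc [OF filippov_curve_rotate [OF \<gamma>] this v_pos right_arc, of \<tau>R "h - \<tau>L"]
    have "- \<gamma> (t + h) = right.flow (h - \<tau>L) (0, v)"
      using h False by (simp add: period_def)
    then show ?thesis
      using False by (simp add: turn_right) (metis minus_minus)
  qed
qed

text \<open>
  From a visit of \<open>(0, u)\<close> on, the solution repeats the revolution for ever; by its own periodicity this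
  accounts for all times.
\<close>

lemma closed_curve_through_cycle:
  assumes \<gamma>: "filippov_curve TL DL aL TR DR aR \<gamma>" and start: "(0, u) \<in> range \<gamma>"
    and P: "P > 0" "\<And>t. \<gamma> (t + P) = \<gamma> t"
  shows "range \<gamma> = cycle"
proof -
  obtain t0 where t0: "\<gamma> t0 = (0, u)"
    using start by (metis rangeE)
  have "\<gamma> (t0 + real n * period) = (0, u)" for n
  proof (induction n)
    case (Suc n)
    then show ?case
      using curve_follows_turn [OF \<gamma> Suc, of period] period_pos by (simp add: algebra_simps)
  qed (simp add: t0)
  note returns = this
  have forward: "\<gamma> t \<in> cycle" if "t0 \<le> t" for t
  proof -
    define n where "n = nat \<lfloor>(t - t0) / period\<rfloor>"
    have n: "real n = of_int \<lfloor>(t - t0) / period\<rfloor>"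
      using that period_pos by (simp add: n_def)
    have "real n \<le> (t - t0) / period" "(t - t0) / period \<le> real n + 1"
      unfolding n by linarith+
    then have "real n * period \<le> t - t0" "t - t0 \<le> (real n + 1) * period"
      by (simp_all only: pos_le_divide_eq [OF period_pos] pos_divide_le_eq [OF period_pos])
    then have h: "0 \<le> t - (t0 + real n * period)" "t - (t0 + real n * period) \<le> period"
      by (simp_all add: algebra_simps)
    have "\<gamma> t = turn (t - (t0 + real n * period))"
      using curve_follows_turn [OF \<gamma> returns h, of n] by simp
    then show ?thesis
      unfolding cycle_def using h by auto
  qed
  have "range \<gamma> = \<gamma> ` {t0..t0 + P}"
    using P by (rule range_periodic)
  then have "range \<gamma> \<subseteq> cycle"
    using forward by auto
  moreover have "turn h \<in> range \<gamma>" if "0 \<le> h" "h \<le> period" for h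
    using curve_follows_turn [OF \<gamma> t0 that] by (metis rangeI)
  ultimately show ?thesis
    unfolding cycle_def by auto
qed

lemma near_cycle_meets_line:
  assumes p: "p \<in> cycle" and "\<epsilon> > 0"
  obtains \<delta> where "\<delta> > 0"
    "\<And>\<gamma> t. \<lbrakk>filippov_curve TL DL aL TR DR aR \<gamma>; dist (\<gamma> t) p < \<delta>\<rbrakk> \<Longrightarrow>
       (\<exists>x. (0, x) \<in> range \<gamma> \<and> \<bar>x - u\<bar> < \<epsilon>) \<or> (\<exists>y. (0, - y) \<in> range \<gamma> \<and> \<bar>y - v\<bar> < \<epsilon>)"
proof -
  obtain h where h: "0 \<le> h" "h \<le> period" "p = turn h"
    using p by (auto simp: cycle_def)
  consider "p = (0, u)" | "p = (0, - v)" | "0 < h" "h < \<tau>L" | "\<tau>L < h" "h < period"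
    using h by (metis less_eq_real_def linorder_neqE_linordered_idom turn_values)
  then show ?thesis
  proof cases
    case 1
    obtain \<delta> where "\<delta> > 0"
      "\<And>\<gamma> t. \<lbrakk>filippov_curve TL DL aL TR DR aR \<gamma>; dist (\<gamma> t) (0, u) < \<delta>\<rbrakk> \<Longrightarrow>
         \<exists>s x. \<gamma> s = (0, x) \<and> \<bar>x - u\<bar> < \<epsilon>"
      by (rule filippov_curve_crosses_upper [OF u_pos \<open>\<epsilon> > 0\<close>]) blast
    then show ?thesis
      using 1 by (intro that [of \<delta>]) (simp_all, metis rangeI)
  next
    case 2
    obtain \<delta> where "\<delta> > 0"
      "\<And>\<gamma> t. \<lbrakk>filippov_curve TL DL aL TR DR aR \<gamma>; dist (\<gamma> t) (0, - v) < \<delta>\<rbrakk> \<Longrightarrow>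
         \<exists>s y. \<gamma> s = (0, - y) \<and> \<bar>y - v\<bar> < \<epsilon>"
      by (rule filippov_curve_crosses_lower [OF v_pos \<open>\<epsilon> > 0\<close>]) blast
    then show ?thesis
      using 2 by (intro that [of \<delta>]) (simp_all, metis rangeI)
  next
    case 3
    obtain \<delta> where "\<delta> > 0"
      "\<And>\<gamma> t. \<lbrakk>filippov_curve TL DL aL TR DR aR \<gamma>; dist (\<gamma> t) (left.flow h (0, u)) < \<delta>\<rbrakk> \<Longrightarrow>
         \<exists>s y. \<gamma> s = (0, - y) \<and> \<bar>y - v\<bar> < \<epsilon>"
      by (rule left.filippov_curve_near_left_arc [OF v_pos \<open>\<epsilon> > 0\<close> left_end left_arc 3]) (assumption | blast)+
    then show ?thesis
      using h(3) turn_left [OF less_imp_le [OF 3(2)]] by (intro that [of \<delta>]) (simp_all, metis rangeI)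
  next
    case 4
    have k: "0 < h - \<tau>L" "h - \<tau>L < \<tau>R"
      using 4 by (simp_all add: period_def)
    obtain \<delta> where \<delta>: "\<delta> > 0"
      "\<And>\<gamma> t. \<lbrakk>filippov_curve TR DR (- aR) TL DL (- aL) \<gamma>; dist (\<gamma> t) (right.flow (h - \<tau>L) (0, v)) < \<delta>\<rbrakk> \<Longrightarrow>
         \<exists>s y. \<gamma> s = (0, - y) \<and> \<bar>y - u\<bar> < \<epsilon>"
      by (rule right.filippov_curve_near_left_arc [OF u_pos \<open>\<epsilon> > 0\<close> right_end right_arc k]) (assumption | blast)+
    show ?thesis
    proof (rule that [OF \<delta>(1)])
      fix \<gamma> t
      assume \<gamma>: "filippov_curve TL DL aL TR DR aR \<gamma>" and "dist (\<gamma> t) p < \<delta>"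
      then have "dist (- \<gamma> t) (right.flow (h - \<tau>L) (0, v)) < \<delta>"
        using dist_minus [of "- \<gamma> t" "right.flow (h - \<tau>L) (0, v)"] 4 by (simp add: h(3) turn_right)
      then obtain s x where "- \<gamma> s = (0, - x)" "\<bar>x - u\<bar> < \<epsilon>"
        using \<delta>(2) [OF filippov_curve_rotate [OF \<gamma>]] by blast
      then have "(0, x) = \<gamma> s" "\<bar>x - u\<bar> < \<epsilon>"
        by (auto simp: prod_eq_iff)
      then show "(\<exists>x. (0, x) \<in> range \<gamma> \<and> \<bar>x - u\<bar> < \<epsilon>) \<or> (\<exists>y. (0, - y) \<in> range \<gamma> \<and> \<bar>y - v\<bar> < \<epsilon>)"
        by (metis rangeI)
    qed
  qed
qed

end

text \<open>
  The neighbourhood \<open>U\<close> is chosen so that a closed orbit that meets it also meets the line near \<open>(0, u)\<close> or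
  near \<open>(0, - v)\<close>; in the latter case the left arc leads back to a height near \<open>u\<close>. The heights of the orbit
  form a closed set because its range is compact, and this set is linked to the set of its depths by the arcs of
  both zones. So the squeezing argument applies.
\<close>

lemma limit_cycle_of_isolated_common_zero:
  assumes left: "focus_zone TL DL aL" and right: "focus_zone TR DR aR"
    and zero: "isolated_common_zero (focus_zone.gap TL DL aL) (focus_zone.gap (- TR) DR (- aR)) u v"
  shows "\<exists>\<Gamma>. limit_cycle (linear_field TL DL aL) (linear_field TR DR aR) \<Gamma>"
proof -
  interpret L: focus_zone TL DL aL
    by (fact left)
  interpret R: focus_zone TR DR "- aR"
    using right by (simp add: focus_zone_def)
  interpret B: focus_zone "- TR" DR "- aR"
    by (rule focus_zone_reverse) (rule R.focus_zone_axioms)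
  have B_gap: "B.gap x y = - R.gap y x" for x y
    by (rule gap_reverse) (rule R.focus_zone_axioms)
  obtain \<epsilon> where uv: "u > 0" "v > 0" "L.gap u v = 0" "B.gap u v = 0" and "\<epsilon> > 0"
    and isolated: "\<And>x y. \<bar>x - u\<bar> < \<epsilon> \<Longrightarrow> \<bar>y - v\<bar> < \<epsilon> \<Longrightarrow> L.gap x y = 0 \<Longrightarrow> B.gap x y = 0 \<Longrightarrow> x = u \<and> y = v"
    using zero unfolding isolated_common_zero_def by blast
  have vu: "R.gap v u = 0"
    using uv(4) B_gap by simp
  obtain \<tau>L where \<tau>L: "\<tau>L > 0" "L.flow \<tau>L (0, u) = (0, - v)"
    "\<And>t. \<lbrakk>0 < t; t < \<tau>L\<rbrakk> \<Longrightarrow> fst (L.flow t (0, u)) < 0"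
    by (rule L.left_half_arc [OF uv(1-3)]) blast
  obtain \<tau>R where \<tau>R: "\<tau>R > 0" "R.flow \<tau>R (0, v) = (0, - u)"
    "\<And>t. \<lbrakk>0 < t; t < \<tau>R\<rbrakk> \<Longrightarrow> fst (R.flow t (0, v)) < 0"
    by (rule R.left_half_arc [OF uv(2,1) vu]) blast
  interpret C: two_arc_cycle TL DL aL TR DR aR u v \<tau>L \<tau>R
    using uv \<tau>L \<tau>R by unfold_locales auto
  define r where "r = min (\<epsilon> / 2) (min u v / 2)"
  have r: "0 < r" "r < u" "r < v" "r < \<epsilon>"
    using uv \<open>\<epsilon> > 0\<close> by (auto simp: r_def)
  have F: "increasing_zero_curve L.gap u v r" and G: "increasing_zero_curve B.gap u v r"
    using uv r by (auto intro!: L.gap_increasing_zero_curve B.gap_increasing_zero_curve)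
  have alone: "x = u" if "\<bar>x - u\<bar> \<le> r" "\<bar>y - v\<bar> \<le> r" "L.gap x y = 0" "B.gap x y = 0" for x y
    using isolated [of x y] that r by simp
  obtain \<delta> where \<delta>: "\<delta> > 0" "\<And>S R. \<lbrakk>closed S; linked_by_zeros L.gap B.gap u v r S R; \<exists>x\<in>S. \<bar>x - u\<bar> \<le> \<delta>\<rbrakk> \<Longrightarrow> u \<in> S"
    by (rule squeeze_to_common_zero [OF F G alone]) (assumption | blast)+
  obtain \<eta> where \<eta>: "\<eta> > 0" "\<And>y. \<bar>y - v\<bar> < \<eta> \<Longrightarrow> \<exists>x>0. \<bar>x - u\<bar> \<le> \<delta> \<and> L.gap x y = 0"
    by (rule L.gap_zero_near [OF uv(3,1,2) \<delta>(1)]) blast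
  define \<kappa> where "\<kappa> = min (min \<delta> \<eta>) v"
  have \<kappa>: "\<kappa> > 0" "\<kappa> \<le> \<delta>" "\<kappa> \<le> \<eta>" "\<kappa> \<le> v"
    using \<delta> \<eta> uv by (auto simp: \<kappa>_def)
  let ?near = "\<lambda>p d. d > 0 \<and> (\<forall>\<gamma> t. filippov_curve TL DL aL TR DR aR \<gamma> \<and> dist (\<gamma> t) p < d \<longrightarrow>
     (\<exists>x. (0, x) \<in> range \<gamma> \<and> \<bar>x - u\<bar> < \<kappa>) \<or> (\<exists>y. (0, - y) \<in> range \<gamma> \<and> \<bar>y - v\<bar> < \<kappa>))"
  have "\<exists>d. ?near p d" if "p \<in> C.cycle" for p
    by (rule C.near_cycle_meets_line [OF that \<kappa>(1)]) blast
  then obtain d where d: "\<And>p. p \<in> C.cycle \<Longrightarrow> ?near p (d p)"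
    by metis
  define U where "U = (\<Union>p\<in>C.cycle. ball p (d p))"
  have "limit_cycle (linear_field TL DL aL) (linear_field TR DR aR) C.cycle"
    unfolding limit_cycle_def
  proof (intro conjI exI [of _ U] allI impI; (elim conjE)?)
    show "closed_crossing_orbit (linear_field TL DL aL) (linear_field TR DR aR) C.cycle"
      by (rule C.cycle_closed_crossing_orbit)
    show "open U"
      by (auto simp: U_def)
    show "C.cycle \<subseteq> U"
      using d by (force simp: U_def)
    fix \<Gamma>' assume "closed_orbit (linear_field TL DL aL) (linear_field TR DR aR) \<Gamma>'" and meets: "\<Gamma>' \<inter> U \<noteq> {}"
    then obtain \<gamma> P where P: "P > 0" "\<And>t. \<gamma> (t + P) = \<gamma> t" and \<Gamma>': "\<Gamma>' = range \<gamma>"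
      and \<gamma>: "filippov_curve TL DL aL TR DR aR \<gamma>"
      unfolding closed_orbit_def using filippov_solution_imp_curve by blast
    obtain p t where p: "p \<in> C.cycle" "dist (\<gamma> t) p < d p"
      using meets unfolding \<Gamma>' U_def by (auto simp: dist_commute)
    have ends: "(0, x) \<in> range \<gamma> \<longleftrightarrow> (0, - y) \<in> range \<gamma>"
      if "x > 0" "y > 0" "L.gap x y = 0 \<or> B.gap x y = 0" for x y
      using that(3)
    proof
      assume "L.gap x y = 0"
      then show ?thesis
        by (rule left_arc_both_ends [OF left \<gamma> that(1,2)])
    next
      assume "B.gap x y = 0"
      then show ?thesis
        using B_gap by (intro right_arc_both_ends [OF right \<gamma> that(1,2)]) simp
    qed
    have "\<exists>x. (0, x) \<in> range \<gamma> \<and> \<bar>x - u\<bar> \<le> \<delta>"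
    proof -
      consider x where "(0, x) \<in> range \<gamma>" "\<bar>x - u\<bar> < \<kappa>" | y where "(0, - y) \<in> range \<gamma>" "\<bar>y - v\<bar> < \<kappa>"
        using d [OF p(1)] \<gamma> p(2) by blast
      then show ?thesis
      proof cases
        case 1
        then show ?thesis
          using \<kappa> by (intro exI [of _ x]) simp
      next
        case 2
        then obtain x where x: "x > 0" "\<bar>x - u\<bar> \<le> \<delta>" "L.gap x y = 0"
          using \<eta>(2) [of y] \<kappa> by auto
        moreover have "y > 0"
          using 2 \<kappa> by simp
        ultimately show ?thesis
          using ends 2 by blast
      qed
    qed
    moreover have "closed {x. (0, x) \<in> range \<gamma>}"
    proof -
      have "compact (range \<gamma>)"
        unfolding range_periodic [of P \<gamma> 0, OF P]
        by (intro compact_continuous_image filippov_curve_continuous [OF \<gamma>] compact_Icc)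
      then have "closed (Pair (0::real) -` range \<gamma>)"
        by (intro continuous_closed_vimage compact_imp_closed continuous_intros)
      then show ?thesis
        by (simp add: vimage_def)
    qed
    moreover have "linked_by_zeros L.gap B.gap u v r {x. (0, x) \<in> range \<gamma>} {y. (0, - y) \<in> range \<gamma>}"
      unfolding linked_by_zeros_def
    proof (intro allI impI; elim conjE)
      fix x y assume "\<bar>x - u\<bar> \<le> r" "\<bar>y - v\<bar> \<le> r" "L.gap x y = 0 \<or> B.gap x y = 0"
      then have "(0, x) \<in> range \<gamma> \<longleftrightarrow> (0, - y) \<in> range \<gamma>"
        using r by (intro ends) auto
      then show "x \<in> {x. (0, x) \<in> range \<gamma>} \<longleftrightarrow> y \<in> {y. (0, - y) \<in> range \<gamma>}"
        by simp
    qed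
    ultimately have "u \<in> {x. (0, x) \<in> range \<gamma>}"
      by (intro \<delta>(2)) auto
    then show "\<Gamma>' = C.cycle"
      unfolding \<Gamma>' by (intro C.closed_curve_through_cycle [OF \<gamma> _ P]) simp
  qed
  then show ?thesis
    by blast
qed

text \<open>
  Used to exclude \<open>aL < 0 < aR\<close>, where both equilibria would be monodromic.
\<close>

lemma (in focus_zone) equilibrium_is_focus:
  assumes "T \<noteq> 0"
  shows "is_focus T D a (a / D, T * a / D)"
proof -
  let ?\<mu> = "Complex (T / 2) freq"
  let ?v = "vector [1, of_real T - ?\<mu>] :: complex ^ 2"
  have "?\<mu> * ?\<mu> = of_real T * ?\<mu> - of_real D"
    using freq_sq by (simp add: complex_eq_iff power2_eq_square)
  then have "?\<mu> * (of_real T - ?\<mu>) = of_real D"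
    by (simp add: right_diff_distrib mult.commute)
  then have "vector [vector [of_real T, -1], vector [of_real D, 0]] *v ?v = ?\<mu> *s ?v"
    by (simp add: vec_eq_iff forall_2 matrix_vector_mult_def sum_2)
  moreover have "?v \<noteq> 0"
    by (simp add: vec_eq_iff forall_2)
  ultimately have "jacobian_eigenvalue T D ?\<mu>"
    unfolding jacobian_eigenvalue_def by blast
  then show ?thesis
    using freq_pos assms D_pos unfolding is_focus_def
    by (intro conjI exI [of _ ?\<mu>]) (auto simp: linear_field_def zero_prod_def)
qed

theorem corollary2:
  fixes TL DL aL TR DR aR \<xi> c0 cinf :: real
    and XL XR :: "real \<times> real \<Rightarrow> real \<times> real"
  assumes XL_eq: "XL = linear_field TL DL aL"
    and XR_eq: "XR = linear_field TR DR aR"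
    and xi_eq: "\<xi> = aR * TL - aL * TR"
    and c0_eq: "c0 = aR * aL * (aR * TL - aL * TR)"
    and cinf_eq: "cinf = TL * (TL\<^sup>2 * DR - TR\<^sup>2 * DL)"
    and "half_map_exists (forward_half_map XL XR)"
    and "half_map_exists (backward_half_map XL XR)"
    and "TL * TR < 0"
    and "c0 \<noteq> 0"
    and "4 * DL - TL\<^sup>2 > 0"
    and "4 * DR - TR\<^sup>2 > 0"
    and "\<exists>!p. monodromic_singularity TL DL aL TR DR aR p"
    and "\<xi> * cinf > 0"
  shows "\<exists>\<Gamma>. limit_cycle XL XR \<Gamma>"
proof -
  have left: "focus_zone TL DL aL" and right: "focus_zone TR DR aR" and reversed: "focus_zone (- TR) DR (- aR)"
    using assms by (auto simp: focus_zone_def)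
  have "aL > 0 \<or> - aR > 0"
  proof (rule ccontr)
    assume "\<not> ?thesis"
    then have a: "aL < 0" "aR > 0"
      using assms(9) c0_eq by auto
    have T: "TL \<noteq> 0" "TR \<noteq> 0"
      using assms(8) by auto
    let ?p = "(aL / DL, TL * aL / DL)" and ?q = "(aR / DR, TR * aR / DR)"
    have sides: "fst ?p < 0" "fst ?q > 0"
      using a focus_zone.D_pos [OF left] focus_zone.D_pos [OF right] by (simp_all add: divide_neg_pos)
    have "monodromic_singularity TL DL aL TR DR aR ?p" "monodromic_singularity TL DL aL TR DR aR ?q"
      unfolding monodromic_singularity_def
      using sides focus_zone.equilibrium_is_focus [OF left T(1)] focus_zone.equilibrium_is_focus [OF right T(2)]
      by blast+
    then have "?p = ?q"
      using assms(12) by blast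
    then show False
      using sides by simp
  qed
  moreover have "TL * - TR > 0"
    using assms(8) by simp
  moreover have "(aL * - TR - - aR * TL) * (TL * (TL\<^sup>2 * DR - (- TR)\<^sup>2 * DL)) > 0"
    using assms(13) by (simp add: xi_eq cinf_eq algebra_simps)
  ultimately obtain u v where
    "isolated_common_zero (focus_zone.gap TL DL aL) (focus_zone.gap (- TR) DR (- aR)) u v"
    using common_zero_of_gaps [OF left reversed] by blast
  then show ?thesis
    unfolding XL_eq XR_eq by (rule limit_cycle_of_isolated_common_zero [OF left right])
qed

end
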